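(* The following four identities hold: \begin{align*} &(zq)_\infty (z^{-1}q)_\infty (q)_\infty R(z;q) \\ &\quad = \frac{1}{2}\sum_{n=0}^\infty \left( \sum_{j=0}^{\lfloor n/2\rfloor} (-1)^{n+j} (z^{n-3j} + z^{3j-n}) q^{\frac{1}{2}(n^2-3j^2) + \frac{1}{2}(n-j)}\right.\\ &\qquad\qquad + \left. \sum_{j=1}^{\lfloor n/2\rfloor} (-1)^{n+j} (z^{n-3j+1} + z^{3j-n-1}) q^{\frac{1}{2}(n^2-3j^2) + \frac{1}{2}(n+j)}\right),\\ &(zq)_\infty (z^{-1}q)_\infty (q)_\infty R(z;q^2) = \sum_{n=0}^\infty \sum_{j=-n}^{n} (-1)^{j} z^j q^{\frac{1}{2}n(3n+1) -j^2}(1- q^{2n+1}),\\ &(1+z)(z^2q;q)_\infty (z^{-2}q;q)_\infty (q;q)_\infty R(z;q) = \sum_{n=0}^\infty \sum_{j=-\lfloor n/2 \rfloor}^{\lfloor n/2\rfloor} (-1)^{n+j} (z^{n+1} + z^{-n}) q^{\frac{1}{2}(n^2-3j^2) + \frac{1}{2}(n-j)},\\ &(1+z)(z^2q^2;q^2)_\infty (z^{-2}q^2;q^2)_\infty (q^2;q^2)_\infty R(z;q)\\ &\quad = \sum_{n=0}^\infty \sum_{j=0}^{2n} (-1)^{n} (z^{j+1} + z^{-j}) q^{3n^2+2n -\frac{1}{2}j(j+1)} - \sum_{n=1}^\infty \sum_{j=0}^{2n-2} (-1)^{n} (z^{j+1} + z^{-j}) q^{3n^2-2n -\frac{1}{2}j(j+1)}.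 \end{align*}
   Context: Here $|q|<1$, $(a;q)_n=(1-a)(1-aq)\cdots(1-aq^{n-1})$, $(a;q)_\infty=\prod_{n\ge1}(1-aq^{n-1})$, and $(a)_\infty=(a;q)_\infty$. The rank generating function is $R(z;q) = \sum_{n\ge0}\sum_m N(m,n) z^m q^n = \sum_{n=0}^\infty \frac{q^{n^2}}{(zq;q)_n(z^{-1}q;q)_n} = \frac{(1-z)}{(q)_\infty} \sum_{n=-\infty}^\infty \frac{(-1)^n q^{n(3n+1)/2}}{1-zq^n}$, where $N(m,n)$ is the number of partitions of $n$ with rank (largest part minus number of parts) equal to $m$. *)

theory Defs
  imports "HOL-Analysis.Analysis"
begin

definition qpoch :: "complex \<Rightarrow> complex \<Rightarrow> nat \<Rightarrow> complex" where
  "qpoch a q n = (\<Prod>k<n. 1 - a * q ^ k)"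

definition qpoch_inf :: "complex \<Rightarrow> complex \<Rightarrow> complex" where
  "qpoch_inf a q = (\<Prod>k. 1 - a * q ^ k)"

definition rank_gf :: "complex \<Rightarrow> complex \<Rightarrow> complex" where
  "rank_gf z q = (\<Sum>n. q ^ (n\<^sup>2) / (qpoch (z * q) q n * qpoch (q / z) q n))"

end

theory Submission
  imports Defs "HOL-Complex_Analysis.Complex_Analysis"
begin

text \<open>
  Multiplied by the theta factors that cancel the poles of \<open>R(z;q)\<close>, each left-hand side is
  holomorphic in \<open>z\<close> on the punctured plane. Telescoping the defining series of \<open>R(z;q)\<close> gives a
  first-order \<open>q\<close>-difference equation \<open>H(zq) = c z^w H(z) + (theta function)\<close> for it. The double
  series satisfies the same equation: the substitution \<open>z \<mapsto> zq\<close> amounts to a shift of the cone of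
  summation, the shifted cone differs from the original one along two boundary rays, and by the
  Jacobi triple product the sums over these rays make up the theta function. The difference of
  the two sides is thus a holomorphic solution of the homogeneous equation. For \<open>w > 0\<close> it is
  zero by Liouville's theorem. In the third identity \<open>w = -1\<close>, where the homogeneous equation
  has a one-dimensional space of solutions, and the symmetry under \<open>z \<mapsto> 1/z\<close> excludes them.
\<close>

section \<open>Infinite products and theta functions\<close>

text \<open>The exponent \<open>w\<close> is a degree count. The cleared rank function alone has
  \<open>w = 2\<close>, and a theta factor lowers this by the power of \<open>z\<close> in its
  argument. One factor of degree one is added in the second identity (where the base of the rank
  function and the shift are \<open>q\<^sup>2\<close>) and in the fourth, so \<open>w = 1\<close>.
  The third needs factors with arguments \<open>- z\<close> and \<open>z\<^sup>2 * q\<close>, so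
  \<open>w = 2 - 1 - 2 = -1\<close>. On Laurent coefficients the homogeneous equation reads
  \<open>a_n q^n = c a_(n-w)\<close>: for \<open>w > 0\<close> nonzero coefficients would grow too
  fast for convergence, while for \<open>w = -1\<close> they decay and a theta function is a genuine
  solution. This is why the third identity needs more than the difference equation. All of this
  requires \<open>q\<close> to be nonzero. For \<open>q = 0\<close> the identities are read off
  directly, since only the row \<open>n = 0\<close> survives.\<close>

lemma qpoch_0 [simp]: "qpoch a q 0 = 1"
  by (simp add: qpoch_def)

lemma qpoch_Suc: "qpoch a q (Suc n) = qpoch a q n * (1 - a * q ^ n)"
  by (simp add: qpoch_def)

lemma qpoch_add: "qpoch a q (m + n) = qpoch a q m * qpoch (a * q ^ m) q n"
  by (induction n) (simp_all add: qpoch_Suc power_add mult_ac)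

lemma qpoch_eq_0_iff: "qpoch a q n = 0 \<longleftrightarrow> (\<exists>k<n. a * q ^ k = 1)"
  by (auto simp: qpoch_def)

lemma summable_norm_geometric_mult:
  fixes a q :: complex
  assumes "norm q < 1"
  shows "summable (\<lambda>k. norm (a * q ^ k))"
  using assms by (auto simp: norm_mult norm_power intro!: summable_mult summable_geometric)

lemma convergent_prod_qpoch:
  assumes "norm q < 1"
  shows "convergent_prod (\<lambda>k. 1 - a * q ^ k :: complex)"
  by (intro abs_convergent_prod_imp_convergent_prod summable_imp_abs_convergent_prod)
     (use summable_norm_geometric_mult[OF assms, of a] in simp)

lemma qpoch_LIMSEQ:
  assumes "norm q < 1"
  shows "qpoch a q \<longlonglongrightarrow> qpoch_inf a q"
proof -
  have "(\<lambda>n. \<Prod>k\<le>n. 1 - a * q ^ k) \<longlonglongrightarrow> qpoch_inf a q"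
    unfolding qpoch_inf_def by (rule convergent_prod_LIMSEQ[OF convergent_prod_qpoch[OF assms]])
  then have "(\<lambda>n. qpoch a q (Suc n)) \<longlonglongrightarrow> qpoch_inf a q"
    by (simp only: qpoch_def lessThan_Suc_atMost)
  then show ?thesis by (rule LIMSEQ_imp_Suc)
qed

lemma qpoch_inf_eqI:
  assumes "norm q < 1" and "qpoch a q \<longlonglongrightarrow> L"
  shows "qpoch_inf a q = L"
  using LIMSEQ_unique[OF qpoch_LIMSEQ[OF assms(1)] assms(2)] .

lemma qpoch_inf_split:
  assumes "norm q < 1"
  shows "qpoch_inf a q = qpoch a q n * qpoch_inf (a * q ^ n) q"
proof (rule qpoch_inf_eqI[OF assms])
  have "(\<lambda>m. qpoch a q n * qpoch (a * q ^ n) q m) \<longlonglongrightarrow> qpoch a q n * qpoch_inf (a * q ^ n) q"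
    by (intro tendsto_intros qpoch_LIMSEQ assms)
  then have "(\<lambda>m. qpoch a q (m + n)) \<longlonglongrightarrow> qpoch a q n * qpoch_inf (a * q ^ n) q"
    by (simp add: qpoch_add add.commute[of _ n])
  then show "qpoch a q \<longlonglongrightarrow> qpoch a q n * qpoch_inf (a * q ^ n) q"
    by (rule LIMSEQ_offset)
qed

lemma qpoch_inf_rec:
  assumes "norm q < 1"
  shows "qpoch_inf a q = (1 - a) * qpoch_inf (a * q) q"
  using qpoch_inf_split[OF assms, of a 1] by (simp add: qpoch_def)

lemma qpoch_inf_0 [simp]: "qpoch_inf a 0 = 1 - a"
proof (rule qpoch_inf_eqI)
  have "qpoch a 0 n = 1 - a" if "n \<ge> 1" for n
    using that by (induction n rule: dec_induct) (simp_all add: qpoch_Suc)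
  then have "eventually (\<lambda>n. qpoch a 0 n = 1 - a) sequentially"
    by (auto simp: eventually_at_top_linorder)
  then show "qpoch a 0 \<longlonglongrightarrow> 1 - a"
    by (rule tendsto_eventually)
qed simp

lemma qpoch_inf_nonzero:
  assumes "norm q < 1" "\<And>k. a * q ^ k \<noteq> 1"
  shows "qpoch_inf a q \<noteq> 0"
  unfolding qpoch_inf_def
  by (rule prodinf_nonzero[OF convergent_prod_qpoch[OF assms(1)]]) (use assms(2) in auto)

lemma mult_power_neq_1:
  assumes "norm (q :: complex) < 1" "norm a \<le> 1" "a \<noteq> 1"
  shows "a * q ^ k \<noteq> 1"
proof (cases k)
  case (Suc m)
  have "norm a * norm q ^ k \<le> norm q ^ k"
    using assms(2) by (simp add: mult_left_le_one_le)
  also have "\<dots> < 1"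
    using assms(1) Suc by (simp add: power_less_one_iff del: power_Suc)
  finally have "norm (a * q ^ k) < 1"
    by (simp add: norm_mult norm_power)
  then show ?thesis by auto
qed (use assms in auto)

lemma qpoch_inf_self_nonzero: "norm q < 1 \<Longrightarrow> qpoch_inf q q \<noteq> 0"
  by (intro qpoch_inf_nonzero mult_power_neq_1) auto

lemma qpoch_self_nonzero: "norm q < 1 \<Longrightarrow> qpoch q q n \<noteq> 0"
  using mult_power_neq_1[of q q] by (force simp: qpoch_eq_0_iff)

lemma norm_qpoch_le:
  assumes "norm q < 1"
  shows "norm (qpoch a q n) \<le> exp (norm a / (1 - norm q))"
proof -
  have "norm (qpoch a q n) = (\<Prod>k<n. norm (1 - a * q ^ k))"
    by (simp add: qpoch_def prod_norm)
  also have "\<dots> \<le> (\<Prod>k<n. 1 + norm (a * q ^ k))"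
    by (intro prod_mono conjI norm_ge_zero order_trans[OF norm_triangle_ineq4]) auto
  also have "\<dots> \<le> exp (\<Sum>k<n. norm (a * q ^ k))"
    by (rule prod_le_exp_sum) auto
  also have "(\<Sum>k<n. norm (a * q ^ k)) \<le> (\<Sum>k. norm (a * q ^ k))"
    by (intro sum_le_suminf summable_norm_geometric_mult assms) auto
  also have "\<dots> = norm a / (1 - norm q)"
    using assms by (simp add: norm_mult norm_power suminf_mult suminf_geometric summable_geometric)
  finally show ?thesis by simp
qed

lemma norm_qpoch_inf_le:
  assumes "norm q < 1"
  shows "norm (qpoch_inf a q) \<le> exp (norm a / (1 - norm q))"
  by (rule LIMSEQ_le_const2[OF tendsto_norm[OF qpoch_LIMSEQ[OF assms]]])
     (use norm_qpoch_le[OF assms] in blast)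

lemma qpoch_inf_even_odd:
  assumes "norm q < 1"
  shows "qpoch_inf a q = qpoch_inf a (q\<^sup>2) * qpoch_inf (a * q) (q\<^sup>2)"
proof -
  have q2: "norm (q\<^sup>2) < 1"
    using assms by (simp add: norm_power power_less_one_iff)
  have eq: "qpoch a q (2 * n) = qpoch a (q\<^sup>2) n * qpoch (a * q) (q\<^sup>2) n" for n
    by (induction n) (simp_all add: qpoch_Suc power_even_eq power_commutes mult_ac flip: power_mult)
  have "(\<lambda>n. qpoch a q (2 * n)) \<longlonglongrightarrow> qpoch_inf a q"
    using LIMSEQ_subseq_LIMSEQ[OF qpoch_LIMSEQ[OF assms, of a], of "\<lambda>n. 2 * n"]
    by (simp add: strict_mono_def o_def)
  moreover have "(\<lambda>n. qpoch a q (2 * n)) \<longlonglongrightarrow> qpoch_inf a (q\<^sup>2) * qpoch_inf (a * q) (q\<^sup>2)"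
    unfolding eq by (intro tendsto_intros qpoch_LIMSEQ q2)
  ultimately show ?thesis by (rule LIMSEQ_unique)
qed

lemma qpoch_inf_square:
  assumes "norm q < 1"
  shows "qpoch_inf (a\<^sup>2) (q\<^sup>2) = qpoch_inf a q * qpoch_inf (- a) q"
proof (rule qpoch_inf_eqI)
  show "norm (q\<^sup>2) < 1"
    using assms by (simp add: norm_power power_less_one_iff)
  have "qpoch (a\<^sup>2) (q\<^sup>2) = (\<lambda>n. qpoch a q n * qpoch (- a) q n)"
    by (rule ext, simp add: qpoch_def flip: prod.distrib)
       (simp add: algebra_simps power2_eq_square power_mult_distrib flip: power_mult)
  then show "qpoch (a\<^sup>2) (q\<^sup>2) \<longlonglongrightarrow> qpoch_inf a q * qpoch_inf (- a) q"
    by (simp add: tendsto_mult qpoch_LIMSEQ assms)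
qed

lemma holomorphic_qpoch_inf:
  assumes "norm q < 1"
  shows "(\<lambda>a. qpoch_inf a q) holomorphic_on UNIV"
proof (rule holomorphic_uniform_sequence[where f = "\<lambda>n a. qpoch a q n"])
  fix x :: complex
  \<comment> \<open>On this ball the factor with index \<open>k\<close> differs from 1 by at most
    \<open>(norm x + 1) * norm q ^ k\<close>. The radius 1 is arbitrary.\<close>
  have "uniformly_convergent_on (cball x 1) (\<lambda>n a. \<Prod>k<n. 1 - a * q ^ k)"
  proof (rule uniformly_convergent_on_prod')
    show "uniformly_convergent_on (cball x 1) (\<lambda>n a. \<Sum>k<n. norm (1 - a * q ^ k - 1))"
    proof (rule Weierstrass_m_test')
      show "norm (norm (1 - a * q ^ k - 1)) \<le> (norm x + 1) * norm q ^ k" if "a \<in> cball x 1" for k a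
      proof -
        have "norm a \<le> norm x + 1"
          using that norm_triangle_ineq2[of a x] by (simp add: dist_norm norm_minus_commute)
        then show ?thesis by (simp add: norm_mult norm_power mult_right_mono)
      qed
      show "summable (\<lambda>k. (norm x + 1) * norm q ^ k)"
        using assms by (intro summable_mult summable_geometric) auto
    qed
  qed (simp_all add: continuous_intros)
  then obtain g where g: "uniform_limit (cball x 1) (\<lambda>n a. qpoch a q n) g sequentially"
    unfolding uniformly_convergent_on_def qpoch_def by blast
  have "g a = qpoch_inf a q" if "a \<in> cball x 1" for a
    using LIMSEQ_unique[OF tendsto_uniform_limitI[OF g that] qpoch_LIMSEQ[OF assms]] .
  then have "uniform_limit (cball x 1) (\<lambda>n a. qpoch a q n) (\<lambda>a. qpoch_inf a q) sequentially"
    using g by (metis (no_types, lifting) uniform_limit_cong')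
  then show "\<exists>d>0. cball x d \<subseteq> UNIV \<and> uniform_limit (cball x d) (\<lambda>n a. qpoch a q n) (\<lambda>a. qpoch_inf a q) sequentially"
    by (intro exI[of _ 1]) auto
qed (simp_all add: qpoch_def holomorphic_on_prod holomorphic_intros)

lemma holomorphic_qpoch_inf' [holomorphic_intros]:
  assumes "norm q < 1" "f holomorphic_on A"
  shows "(\<lambda>z. qpoch_inf (f z) q) holomorphic_on A"
  using holomorphic_on_compose[OF assms(2) holomorphic_on_subset[OF holomorphic_qpoch_inf[OF assms(1)]]]
  by (simp add: o_def)

text \<open>The Jacobi theta function without its factor \<open>(q;q)_inf\<close>. For
  \<open>0 < norm q < 1\<close> its zeros are exactly the integer powers of
  \<open>q\<close>.\<close>

definition theta :: "complex \<Rightarrow> complex \<Rightarrow> complex" where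
  "theta q z = qpoch_inf z q * qpoch_inf (q / z) q"

lemma holomorphic_theta [holomorphic_intros]:
  assumes "norm q < 1" "f holomorphic_on A" "\<And>z. z \<in> A \<Longrightarrow> f z \<noteq> 0"
  shows "(\<lambda>z. theta q (f z)) holomorphic_on A"
  unfolding theta_def using assms by (intro holomorphic_intros) auto

text \<open>The shift removes the factor \<open>1 - z\<close> from one product and adds
  \<open>1 - 1 / z\<close> to the other; the quotient of the two is \<open>- 1 / z\<close>.\<close>

lemma theta_mult_q:
  assumes "norm q < 1" "q \<noteq> 0" "z \<noteq> 0"
  shows "theta q (z * q) = - theta q z / z"
proof -
  have "theta q (z * q) = qpoch_inf (z * q) q * qpoch_inf (1 / z) q"
    using assms by (simp add: theta_def)
  also have "qpoch_inf (1 / z) q = (1 - 1 / z) * qpoch_inf (q / z) q"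
    using qpoch_inf_rec[OF assms(1), of "1 / z"] by simp
  finally show ?thesis
    using assms by (simp add: theta_def qpoch_inf_rec[OF assms(1), of z] field_simps)
qed

lemma theta_inverse:
  assumes "norm q < 1" "z \<noteq> 0"
  shows "theta q (1 / z) = - theta q z / z"
proof -
  have "theta q (1 / z) = (1 - 1 / z) * (qpoch_inf (q / z) q * qpoch_inf (z * q) q)"
    using assms qpoch_inf_rec[OF assms(1), of "1 / z"] by (simp add: theta_def mult.commute[of q z])
  also have "\<dots> = - ((1 - z) * qpoch_inf (z * q) q * qpoch_inf (q / z) q) / z"
    using assms(2) by (simp add: field_simps)
  finally show ?thesis
    by (simp add: theta_def qpoch_inf_rec[OF assms(1), of z])
qed

text \<open>This lemma and \<open>theta_even_odd\<close> fuse the theta factor that multiplies the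
  rank function with the theta function in the difference equation of the latter. The inhomogeneous
  term thus becomes a single theta function, to which the triple product applies.\<close>

lemma theta_square:
  assumes "norm q < 1"
  shows "theta (q\<^sup>2) (z\<^sup>2) = theta q z * theta q (- z)"
proof -
  have "qpoch_inf (q\<^sup>2 / z\<^sup>2) (q\<^sup>2) = qpoch_inf (q / z) q * qpoch_inf (q / - z) q"
    using qpoch_inf_square[OF assms, of "q / z"] by (simp add: power_divide)
  then show ?thesis
    by (simp add: theta_def qpoch_inf_square[OF assms])
qed

lemma theta_even_odd:
  assumes "norm q < 1" "q \<noteq> 0" "z \<noteq> 0"
  shows "theta q z = theta (q\<^sup>2) z * theta (q\<^sup>2) (z * q)"
proof -
  have "q\<^sup>2 / (z * q) = q / z" using assms by (simp add: power2_eq_square)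
  then show ?thesis using assms(2)
    by (simp add: theta_def qpoch_inf_even_odd[OF assms(1), of z] qpoch_inf_even_odd[OF assms(1), of "q / z"]
        power2_eq_square mult_ac)
qed

section \<open>Holomorphic quasi-periodic functions\<close>

text \<open>Every smaller \<open>z\<close> is reached from the compact annulus
  \<open>\<delta> * norm q \<le> norm z \<le> \<delta>\<close> by finitely many multiplications by
  \<open>q\<close>, and none of them increases \<open>norm (H z)\<close>.\<close>

lemma bounded_near_0_quasi_periodic:
  fixes H :: "complex \<Rightarrow> complex"
  assumes cont: "continuous_on (- {0}) H" and q: "norm q < 1" "q \<noteq> 0" and "\<delta> > 0"
    and decr: "\<And>z. z \<noteq> 0 \<Longrightarrow> norm z \<le> \<delta> \<Longrightarrow> norm (H (z * q)) \<le> norm (H z)"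
  shows "\<exists>B. \<forall>z. z \<noteq> 0 \<longrightarrow> norm z \<le> \<delta> \<longrightarrow> norm (H z) \<le> B"
proof -
  define K where "K = cball 0 \<delta> - ball (0::complex) (\<delta> * norm q)"
  have "compact K"
    unfolding K_def by (intro compact_diff) auto
  moreover have "K \<subseteq> - {0}"
    using q \<open>\<delta> > 0\<close> by (auto simp: K_def)
  ultimately have "compact (H ` K)"
    by (intro compact_continuous_image continuous_on_subset[OF cont])
  then have "\<exists>B. \<forall>z\<in>K. norm (H z) \<le> B"
    by (auto dest!: compact_imp_bounded simp: bounded_iff)
  then obtain B where B: "\<And>z. z \<in> K \<Longrightarrow> norm (H z) \<le> B"
    by blast
  \<comment> \<open>\<open>n\<close> bounds the number of multiplications by \<open>q\<close> that
    lead from \<open>K\<close> to \<open>z\<close>; the induction step passes from \<open>z\<close>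
    to \<open>z / q\<close>.\<close>
  have claim: "norm (H z) \<le> B" if "norm z \<le> \<delta>" "\<delta> * norm q ^ Suc n \<le> norm z" for n z
    using that
  proof (induction n arbitrary: z)
    case 0
    then show ?case by (intro B) (simp add: K_def)
  next
    case (Suc n)
    show ?case
    proof (cases "\<delta> * norm q \<le> norm z")
      case True
      then show ?thesis using Suc.prems by (intro B) (simp add: K_def)
    next
      case False
      have pos: "0 < \<delta> * norm q ^ Suc (Suc n)" using q \<open>\<delta> > 0\<close> by simp
      have z: "norm (z / q) \<le> \<delta>" "\<delta> * norm q ^ Suc n \<le> norm (z / q)" "z \<noteq> 0"
        using False Suc.prems q pos by (auto simp: norm_divide field_simps)
      then have "norm (H (z / q * q)) \<le> norm (H (z / q))"
        using q by (intro decr) auto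
      also have "\<dots> \<le> B" by (rule Suc.IH[OF z(1,2)])
      finally show ?thesis using q by simp
    qed
  qed
  have "norm (H z) \<le> B" if "z \<noteq> 0" "norm z \<le> \<delta>" for z
  proof -
    have "0 < norm z / \<delta>"
      using that \<open>\<delta> > 0\<close> by simp
    then obtain n where "norm q ^ n < norm z / \<delta>"
      using real_arch_pow_inv q(1) by blast
    moreover have "norm q ^ Suc n \<le> norm q ^ n"
      using q by (intro power_decreasing) auto
    ultimately have "norm q ^ Suc n \<le> norm z / \<delta>"
      by simp
    then have "\<delta> * norm q ^ Suc n \<le> norm z"
      using \<open>\<delta> > 0\<close> by (simp add: field_simps del: power_Suc)
    then show ?thesis using claim that by blast
  qed
  then show ?thesis by blast
qed

text \<open>Boundedness makes the singularity at 0 removable, and the extension is a bounded entire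
  function.\<close>

lemma holomorphic_punctured_plane_bounded_imp_constant:
  fixes H :: "complex \<Rightarrow> complex"
  assumes "H holomorphic_on (- {0})" and B: "\<And>z. z \<noteq> 0 \<Longrightarrow> norm (H z) \<le> B"
  shows "\<exists>c. \<forall>z. z \<noteq> 0 \<longrightarrow> H z = c"
proof -
  have "H \<in> O[at 0](\<lambda>_. 1)"
    by (rule landau_o.bigI[of "max 1 B"])
       (auto simp: eventually_at_filter intro!: always_eventually B order_trans[OF B] mult_left_le)
  then obtain g where g: "g holomorphic_on UNIV" "\<And>z. z \<noteq> 0 \<Longrightarrow> g z = H z"
    using holomorphic_on_extend[of H UNIV 0] assms(1) by (auto simp: Compl_eq_Diff_UNIV)
  have "bounded (range g)"
    unfolding bounded_iff
  proof (intro exI ballI, clarify)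
    show "norm (g z) \<le> max B (norm (g 0))" for z
      using B[of z] g(2)[of z] by (cases "z = 0") auto
  qed
  then show ?thesis
    using Liouville_theorem[OF g(1)] g(2) unfolding constant_on_def by (metis UNIV_I)
qed

text \<open>
  Near the origin the factor \<open>c * z ^ w\<close> is small and near infinity it is large, so in both
  regions the functional equation bounds \<open>H\<close> by its values on a fixed annulus.
\<close>

lemma quasi_periodic_eq_0:
  fixes H :: "complex \<Rightarrow> complex"
  assumes hol: "H holomorphic_on (- {0})" and q: "norm q < 1" "q \<noteq> 0" and c: "c \<noteq> 0" and w: "w > 0"
    and fe: "\<And>z. z \<noteq> 0 \<Longrightarrow> H (z * q) = c * z ^ w * H z"
    and z: "z \<noteq> 0"
  shows "H z = 0"
proof -
  have small: "\<exists>\<delta>>0. \<forall>z. norm z \<le> \<delta> \<longrightarrow> norm (d * z ^ w) \<le> 1" for d :: complex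
  proof -
    have "((\<lambda>z. norm (d * z ^ w)) \<longlongrightarrow> norm (d * 0 ^ w)) (nhds 0)"
      by (intro tendsto_intros filterlim_ident)
    then have "eventually (\<lambda>z. norm (d * z ^ w) < 1) (nhds 0)"
      using w by (intro order_tendstoD(2)) (auto simp: power_0_left)
    then obtain e where "e > 0" "\<And>z. norm z < e \<Longrightarrow> norm (d * z ^ w) < 1"
      by (auto simp: eventually_nhds_metric)
    then show ?thesis
      by (intro exI[of _ "e / 2"]) (auto intro: less_imp_le)
  qed
  obtain \<delta> where \<delta>: "\<delta> > 0" "\<And>z. norm z \<le> \<delta> \<Longrightarrow> norm (c * z ^ w) \<le> 1"
    using small[of c] by blast
  obtain \<epsilon> where \<epsilon>: "\<epsilon> > 0" "\<And>z. norm z \<le> \<epsilon> \<Longrightarrow> norm (q ^ w / c * z ^ w) \<le> 1"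
    using small[of "q ^ w / c"] by blast
  \<comment> \<open>Inversion carries infinity to 0 and turns the equation into one of the same
    shape with constant \<open>q ^ w / c\<close>, so the estimate near 0 can be used a second
    time.\<close>
  define G where "G = (\<lambda>z. H (1 / z))"
  have contH: "continuous_on (- {0}) H"
    using hol by (rule holomorphic_on_imp_continuous_on)
  have contG: "continuous_on (- {0}) G"
    unfolding G_def by (rule continuous_on_compose2[OF contH]) (auto intro!: continuous_intros)
  have G: "G (z * q) = q ^ w / c * z ^ w * G z" if "z \<noteq> 0" for z
    using fe[of "1 / (z * q)"] that q c by (simp add: G_def field_simps)
  obtain B1 where B1: "\<And>z. z \<noteq> 0 \<Longrightarrow> norm z \<le> \<delta> \<Longrightarrow> norm (H z) \<le> B1"
    using bounded_near_0_quasi_periodic[OF contH q \<delta>(1)] \<delta>(2) fe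
    by (metis norm_mult mult_left_le_one_le norm_ge_zero)
  obtain B2 where B2: "\<And>z. z \<noteq> 0 \<Longrightarrow> norm z \<le> \<epsilon> \<Longrightarrow> norm (G z) \<le> B2"
    using bounded_near_0_quasi_periodic[OF contG q \<epsilon>(1)] \<epsilon>(2) G
    by (metis norm_mult mult_left_le_one_le norm_ge_zero)
  have "compact (H ` (cball 0 (1 / \<epsilon>) - ball 0 \<delta>))"
    using \<delta>(1) by (intro compact_continuous_image continuous_on_subset[OF contH] compact_diff) auto
  then have "\<exists>B. \<forall>z\<in>cball 0 (1 / \<epsilon>) - ball 0 \<delta>. norm (H z) \<le> B"
    by (auto dest!: compact_imp_bounded simp: bounded_iff)
  then obtain B3 where "\<And>z. z \<in> cball 0 (1 / \<epsilon>) - ball 0 \<delta> \<Longrightarrow> norm (H z) \<le> B3"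
    by blast
  then have B3: "norm (H z) \<le> B3" if "\<delta> \<le> norm z" "norm z \<le> 1 / \<epsilon>" for z
    using that by simp
  have "norm (H z) \<le> max B1 (max B2 B3)" if "z \<noteq> 0" for z
  proof -
    consider "norm z \<le> \<delta>" | "norm (1 / z) \<le> \<epsilon>" | "\<delta> \<le> norm z" "norm z \<le> 1 / \<epsilon>"
      using \<epsilon>(1) \<open>z \<noteq> 0\<close> by (cases "norm z \<le> 1 / \<epsilon>"; cases "\<delta> \<le> norm z") (auto simp: norm_divide field_simps)
    then show ?thesis
      using B1[OF that] B2[of "1 / z"] B3[of z] that by cases (auto simp: G_def le_max_iff_disj)
  qed
  then obtain h where h: "\<And>z. z \<noteq> 0 \<Longrightarrow> H z = h"
    using holomorphic_punctured_plane_bounded_imp_constant[OF hol] by metis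
  \<comment> \<open>A multiplier of modulus below 1 forces the constant \<open>h\<close> to vanish.
    At modulus \<open>\<delta>\<close> it is only known to be at most 1; the extra factor
    \<open>q\<close> makes the bound strict.\<close>
  obtain x where x: "x \<noteq> 0" "norm (c * x ^ w) < 1"
  proof
    show "of_real \<delta> * q \<noteq> 0" using \<delta>(1) q by simp
    have "norm (c * (of_real \<delta> * q) ^ w) = norm (c * of_real \<delta> ^ w) * norm q ^ w"
      by (simp add: norm_mult norm_power power_mult_distrib)
    also have "\<dots> \<le> 1 * norm q ^ w"
      using \<delta> by (intro mult_right_mono) auto
    also have "\<dots> < 1" using q w by (simp add: power_less_one_iff)
    finally show "norm (c * (of_real \<delta> * q) ^ w) < 1" .
  qed
  have "h = c * x ^ w * h" using fe[of x] h x q by simp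
  then have "h = 0" using x(2) by auto
  then show ?thesis using h z by simp
qed

lemma theta_minus_factor:
  assumes "norm q < 1"
  shows "theta q (- z) = (1 + z) * (qpoch_inf (- z * q) q * qpoch_inf (- q / z) q)"
  by (simp add: theta_def qpoch_inf_rec[OF assms, of "- z"])

text \<open>
  The symmetry forces a zero at \<open>-1\<close>, so \<open>H\<close> is divisible by \<open>theta q (- z)\<close>.
  The quotient changes sign under \<open>z \<mapsto> z * q\<close>, so it is bounded, hence constant, hence zero.
\<close>

lemma quasi_periodic_symmetric_eq_0:
  fixes H :: "complex \<Rightarrow> complex"
  assumes hol: "H holomorphic_on (- {0})" and q: "norm q < 1" "q \<noteq> 0"
    and fe: "\<And>z. z \<noteq> 0 \<Longrightarrow> H (z * q) = - H z / z"
    and sym: "\<And>z. z \<noteq> 0 \<Longrightarrow> H (1 / z) = H z / z"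
    and z: "z \<noteq> 0"
  shows "H z = 0"
proof -
  \<comment> \<open>\<open>A\<close> is narrow enough that \<open>-1\<close> is the only zero of
    \<open>theta q (- z)\<close> in it, and wide enough to contain a closed fundamental annulus of
    the shift.\<close>
  define A where "A = {z::complex. norm q < norm (z - 0) \<and> norm (z - 0) < 1 / norm q}"
  have A: "open A" "connected A"
    by (unfold A_def, intro open_Collect_conj open_Collect_less continuous_intros)
       (rule connected_annulus, simp)
  have A0: "A \<subseteq> - {0}" using q by (auto simp: A_def)
  define h where "h = (\<lambda>z. if z = -1 then deriv H (-1) else (H z - H (-1)) / (z - (-1)))"
  define t where "t = (\<lambda>z. qpoch_inf (- z * q) q * qpoch_inf (- q / z) q)"
  have "H (-1) = 0" using sym[of "-1"] by simp
  have h: "H z = (1 + z) * h z" for z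
    using \<open>H (-1) = 0\<close> by (auto simp: h_def add_eq_0_iff add.commute)
  have holh: "h holomorphic_on A"
    unfolding h_def by (rule pole_lemma_open[OF holomorphic_on_subset[OF hol A0] A(1)])
  have t: "t z \<noteq> 0" if "z \<in> A" for z
  proof -
    have "norm (- z * q * q ^ k) < 1" "norm (- q / z * q ^ k) < 1" for k
    proof -
      have "norm z > 0"
        using that A0 by auto
      then have 1: "norm (z * q) < 1" "norm (q / z) < 1"
        using that q by (auto simp: A_def norm_mult norm_divide field_simps)
      have 2: "norm (q ^ k) \<le> 1"
        using q by (simp add: norm_power power_le_one)
      have "norm (x * q ^ k) < 1" if "norm x < 1" for x
        using that 2 by (simp add: norm_mult) (meson mult_left_le norm_ge_zero order_le_less_trans)
      from this[OF 1(1)] this[OF 1(2)] show "norm (- z * q * q ^ k) < 1" "norm (- q / z * q ^ k) < 1"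
        by (simp_all add: norm_mult norm_divide)
    qed
    then show ?thesis
      unfolding t_def by (metis mult_eq_0_iff norm_one order_less_irrefl q(1) qpoch_inf_nonzero)
  qed
  define Q where "Q = (\<lambda>z. h z / t z)"
  have holQ: "Q holomorphic_on A"
    unfolding Q_def t_def using t A0 q(1) unfolding t_def
    by (intro holomorphic_intros holh) auto
  \<comment> \<open>The condition \<open>norm z > 1\<close> puts \<open>z * q\<close> into
    \<open>A\<close> too, strictly inside the unit circle. Both points then avoid the zero at
    \<open>-1\<close>, and the theta factors cancel.\<close>
  have Qq: "Q (z * q) = - Q z" if "norm z > 1" "z \<in> A" for z
  proof -
    have zq1: "norm (z * q) < 1" "norm q < norm (z * q)" "1 < 1 / norm q"
      using that q by (auto simp: A_def norm_mult field_simps)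
    have zq: "z * q \<in> A" "norm (z * q) < 1"
      unfolding A_def using zq1 order.strict_trans[OF zq1(1,3)] by auto
    have *: "H w = Q w * theta q (- w)" "theta q (- w) \<noteq> 0" if "w \<in> A" "norm w \<noteq> 1" for w
      using t[OF that(1)] that(2) h[of w] theta_minus_factor[OF q(1), of w]
      by (auto simp: Q_def t_def add_eq_0_iff)
    have "theta q (- (z * q)) = theta q (- z) / z"
      using theta_mult_q[OF q, of "- z"] that A0 by auto
    then have "Q (z * q) * (theta q (- z) / z) = - Q z * (theta q (- z) / z)"
      using fe[of z] *(1)[OF zq(1)] *(1)[OF that(2)] that zq A0 by auto
    moreover have "theta q (- z) / z \<noteq> 0"
      using *(2)[OF that(2)] that by auto
    ultimately show ?thesis using mult_right_cancel by blast
  qed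
  \<comment> \<open>As \<open>r * r = norm q\<close>, the shift carries the circle of radius
    \<open>1 / r\<close> to that of radius \<open>r\<close>, so the closed annulus \<open>K\<close>
    between them is fundamental. Since \<open>norm (Q z)\<close> is invariant under the shift, its
    maximum on \<open>K\<close> is its maximum on the open set \<open>A\<close>, and the maximum
    modulus principle applies.\<close>
  define r where "r = sqrt (norm q)"
  have r: "norm q < r" "r < 1" "r * r = norm q" "r > 0"
    using q by (auto simp: r_def real_less_rsqrt power2_eq_square mult_less_cancel_left2)
  define K where "K = cball 0 (1 / r) - ball (0::complex) r"
  have K: "K \<subseteq> A" "compact K" "of_real r \<in> K"
  proof -
    have "1 / r < 1 / norm q" using r q by (intro divide_strict_left_mono) auto
    then show "K \<subseteq> A" using r by (auto simp: K_def A_def)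
    have "r \<le> 1 / r" using r by (simp add: field_simps mult_le_one)
    then show "of_real r \<in> K" using r by (auto simp: K_def)
  qed (auto simp: K_def intro!: compact_diff)
  have "continuous_on K (\<lambda>z. norm (Q z))"
    by (intro continuous_intros holomorphic_on_imp_continuous_on holomorphic_on_subset[OF holQ] K)
  then obtain x where x: "x \<in> K" "\<And>y. y \<in> K \<Longrightarrow> norm (Q y) \<le> norm (Q x)"
    using continuous_attains_sup[OF K(2)] K(3) by blast
  have "norm (Q z) \<le> norm (Q x)" if "z \<in> A" for z
  proof (cases "z \<in> K")
    case True
    then show ?thesis by (rule x(2))
  next
    case False
    then consider "norm z < r" | "norm z > 1 / r" by (auto simp: K_def)
    then show ?thesis
    proof cases
      case 1
      have "norm q < norm z" using \<open>z \<in> A\<close> by (simp add: A_def)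
      moreover from this have "r * norm q \<le> norm z"
        using r by (intro order_trans[OF mult_left_le_one_le[of "norm q" r]]) auto
      moreover have "r * norm z \<le> norm q"
        unfolding r(3)[symmetric] using r 1 by (intro mult_left_mono) auto
      ultimately have z: "norm (z / q) > 1" "z / q \<in> K"
        using q r by (auto simp: K_def norm_divide field_simps)
      show ?thesis using Qq[OF z(1)] K(1) x(2)[OF z(2)] z(2) q by auto
    next
      case 2
      have "norm q * norm z < 1" using \<open>z \<in> A\<close> q by (simp add: A_def field_simps)
      moreover have *: "1 \<le> 1 / r"
        using r by simp
      moreover have "1 < norm z"
        using order.strict_trans1[OF * 2] .
      moreover have "r * 1 \<le> r * (r * norm z)"
        using r 2 by (intro mult_left_mono) (auto simp: field_simps)
      then have "r \<le> r * r * norm z"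
        by (simp add: mult.assoc)
      ultimately have z: "norm z > 1" "z * q \<in> K"
        using r(3) by (auto simp: K_def norm_mult mult.commute)
      show ?thesis using Qq[OF z(1) that] x(2)[OF z(2)] q by simp
    qed
  qed
  then have "Q constant_on A"
    using maximum_modulus_principle[OF holQ A(1,2) A(1) order_refl, of x] x(1) K(1) by blast
  then obtain k where k: "\<And>z. z \<in> A \<Longrightarrow> Q z = k" unfolding constant_on_def by blast
  \<comment> \<open>The point \<open>1 / r\<close> and its image under the shift both lie in
    \<open>A\<close>, so the constant value of \<open>Q\<close> equals its own negative.\<close>
  have "norm (1 / of_real r * q) = r" "r \<le> 1 / r"
    using K(3) r by (auto simp: norm_divide norm_mult field_simps K_def)
  then have "1 / of_real r \<in> A" "norm (1 / of_real r :: complex) > 1" "1 / of_real r * q \<in> A"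
    using r K(1) by (auto simp: K_def norm_divide)
  then have "k = - k" using Qq k by metis
  then have "k = 0" by simp
  then have "H z = 0" if "z \<in> A" for z
    using k[OF that] t[OF that] h[of z] by (simp add: Q_def)
  then show ?thesis
    using analytic_continuation_open[of A "- {0}" H "\<lambda>_. 0" z] A A0 K x(1) hol z
    by (auto simp: connected_punctured_universe)
qed

section \<open>The rank generating function\<close>

text \<open>
  Termwise cancellation of the denominators makes this meaningful for all \<open>z \<noteq> 0\<close>, including the
  poles of the rank generating function.
\<close>

definition cleared_rank :: "complex \<Rightarrow> complex \<Rightarrow> complex" where
  "cleared_rank q z =
     qpoch_inf q q * (\<Sum>n. q ^ n\<^sup>2 * (qpoch_inf (z * q ^ Suc n) q * qpoch_inf (q ^ Suc n / z) q))"

lemma power_square_le: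
  fixes x :: real
  assumes "0 \<le> x" "x \<le> 1"
  shows "x ^ n\<^sup>2 \<le> x ^ n"
  using assms by (intro power_decreasing) (auto simp: power2_eq_square)

text \<open>The bound depends on \<open>z\<close> only through \<open>R\<close>, that is, it is
  uniform on an annulus. It therefore serves both for summability at a point and for locally uniform
  convergence.\<close>

lemma norm_cleared_rank_term_le:
  assumes "norm q < 1" "norm z \<le> R" "norm (1 / z) \<le> R"
  shows "norm (q ^ n\<^sup>2 * (qpoch_inf (z * q ^ Suc n) q * qpoch_inf (q ^ Suc n / z) q))
    \<le> norm q ^ n * exp (R / (1 - norm q)) ^ 2"
proof -
  have *: "norm (qpoch_inf (a * q ^ Suc n) q) \<le> exp (R / (1 - norm q))" if "norm a \<le> R" for a
  proof -
    have "norm q ^ Suc n \<le> 1"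
      using assms(1) by (intro power_le_one) auto
    then have "norm (a * q ^ Suc n) \<le> R"
      using that by (simp add: norm_mult norm_power del: power_Suc) (meson mult_left_le norm_ge_zero order_trans)
    then have "exp (norm (a * q ^ Suc n) / (1 - norm q)) \<le> exp (R / (1 - norm q))"
      using assms(1) by (simp add: divide_right_mono)
    then show ?thesis using norm_qpoch_inf_le[OF assms(1)] by (rule order_trans[rotated])
  qed
  have "norm (qpoch_inf (z * q ^ Suc n) q * qpoch_inf (q ^ Suc n / z) q)
    \<le> exp (R / (1 - norm q)) * exp (R / (1 - norm q))"
    unfolding norm_mult using *[OF assms(2)] *[OF assms(3)]
    by (intro mult_mono) auto
  then show ?thesis
    unfolding norm_mult[of "q ^ n\<^sup>2"] norm_power power2_eq_square[of "exp _"]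
    using power_square_le[of "norm q" n] assms(1) by (intro mult_mono) auto
qed

lemma summable_cleared_rank:
  assumes "norm q < 1"
  shows "summable (\<lambda>n. q ^ n\<^sup>2 * (qpoch_inf (z * q ^ Suc n) q * qpoch_inf (q ^ Suc n / z) q))"
proof (rule summable_comparison_test')
  define R where "R = max (norm z) (norm (1 / z))"
  show "summable (\<lambda>n. norm q ^ n * exp (R / (1 - norm q)) ^ 2)"
    using assms by (intro summable_mult2 summable_geometric) auto
  show "norm (q ^ n\<^sup>2 * (qpoch_inf (z * q ^ Suc n) q * qpoch_inf (q ^ Suc n / z) q))
    \<le> norm q ^ n * exp (R / (1 - norm q)) ^ 2" for n
    using assms by (intro norm_cleared_rank_term_le) (auto simp: R_def)
qed

lemma holomorphic_cleared_rank:
  assumes "norm q < 1"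
  shows "cleared_rank q holomorphic_on (- {0})"
proof -
  define U where "U = (\<lambda>n z. q ^ n\<^sup>2 * (qpoch_inf (z * q ^ Suc n) q * qpoch_inf (q ^ Suc n / z) q))"
  have "(\<lambda>z. \<Sum>n. U n z) holomorphic_on (- {0})"
  proof (rule holomorphic_uniform_sequence[where f = "\<lambda>n z. \<Sum>i<n. U i z"])
    fix x :: complex
    assume x: "x \<in> - {0}"
    \<comment> \<open>On the ball of radius \<open>norm x / 2\<close> around \<open>x\<close>,
      \<open>norm z\<close> stays between \<open>norm x / 2\<close> and \<open>2 * norm x\<close>,
      so \<open>R\<close> bounds both \<open>norm z\<close> and \<open>norm (1 / z)\<close>.\<close>
    define R where "R = max (2 * norm x) (2 / norm x)"
    have nz: "norm z \<ge> norm x / 2" "norm z \<le> 2 * norm x" if "z \<in> cball x (norm x / 2)" for z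
      using that norm_triangle_ineq2[of z x] norm_triangle_ineq2[of x z]
      by (auto simp: dist_norm norm_minus_commute)
    have "uniform_limit (cball x (norm x / 2)) (\<lambda>n z. \<Sum>i<n. U i z) (\<lambda>z. \<Sum>n. U n z) sequentially"
    proof (rule Weierstrass_m_test)
      show "summable (\<lambda>n. norm q ^ n * exp (R / (1 - norm q)) ^ 2)"
        using assms by (intro summable_mult2 summable_geometric) auto
      show "norm (U n z) \<le> norm q ^ n * exp (R / (1 - norm q)) ^ 2" if "z \<in> cball x (norm x / 2)" for n z
      proof -
        have "norm z > 0" using nz[OF that] x by (smt (verit) ComplD divide_pos_pos singletonI zero_less_norm_iff)
        then have "norm z \<le> R" "norm (1 / z) \<le> R"
          using nz[OF that] x by (auto simp: R_def norm_divide le_max_iff_disj field_simps)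
        then show ?thesis
          unfolding U_def by (intro norm_cleared_rank_term_le assms)
      qed
    qed
    moreover have "cball x (norm x / 2) \<subseteq> - {0}"
    proof
      fix z assume "z \<in> cball x (norm x / 2)"
      from nz(1)[OF this] x show "z \<in> - {0}" by auto
    qed
    ultimately show "\<exists>d>0. cball x d \<subseteq> - {0} \<and>
        uniform_limit (cball x d) (\<lambda>n z. \<Sum>i<n. U i z) (\<lambda>z. \<Sum>n. U n z) sequentially"
      using x by (intro exI[of _ "norm x / 2"]) auto
  next
    show "(\<lambda>z. \<Sum>i<n. U i z) holomorphic_on - {0}" for n
      unfolding U_def using assms by (intro holomorphic_intros) auto
  qed auto
  then have "(\<lambda>z. qpoch_inf q q * (\<Sum>n. U n z)) holomorphic_on (- {0})"
    by (intro holomorphic_intros)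
  then show ?thesis
    by (simp add: cleared_rank_def[abs_def] U_def)
qed

text \<open>Inversion merely swaps the two products in each term. This is the source of the symmetry
  used for the third identity and of the factor \<open>1/2\<close> in the first.\<close>

lemma cleared_rank_inverse: "cleared_rank q (1 / z) = cleared_rank q z"
  by (simp add: cleared_rank_def mult_ac)

text \<open>
  The difference of the two series telescopes, the antidifference being
  \<open>(q * z\<^sup>2 - 1) * (1 - q ^ n / z)\<close> times the \<open>n\<close>-th term of the series for \<open>z\<close>.
\<close>

lemma cleared_rank_mult_q:
  assumes q: "norm q < 1" "q \<noteq> 0" and z: "z \<noteq> 0"
  shows "cleared_rank q (z * q) = q * z\<^sup>2 * cleared_rank q z + (q * z - 1 / z) * (qpoch_inf q q * theta q z)"
proof -
  define U where "U = (\<lambda>z n. q ^ n\<^sup>2 * (qpoch_inf (z * q ^ Suc n) q * qpoch_inf (q ^ Suc n / z) q))"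
  define W where "W = (\<lambda>n. (q * z\<^sup>2 - 1) * (1 - q ^ n / z) * U z n)"
  have summ: "summable (U z)" for z
    unfolding U_def by (rule summable_cleared_rank[OF q(1)])
  \<comment> \<open>All terms are multiples of \<open>q ^ n\<^sup>2 * X * Y\<close>: in
    \<open>W (Suc n)\<close> the factor \<open>1 - q ^ Suc n / z\<close> completes the shorter
    product to \<open>Y\<close>. What remains is an elementary identity in \<open>z\<close> and
    \<open>q ^ n\<close>.\<close>
  have step: "U (z * q) n - q * z\<^sup>2 * U z n = W (Suc n) - W n" for n
  proof -
    define X where "X = qpoch_inf (z * q ^ Suc (Suc n)) q"
    define Y where "Y = qpoch_inf (q ^ Suc n / z) q"
    have X: "qpoch_inf (z * q ^ Suc n) q = (1 - z * q ^ Suc n) * X"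
      using qpoch_inf_rec[OF q(1), of "z * q ^ Suc n"] by (simp add: X_def mult_ac)
    have Y: "Y = (1 - q ^ Suc n / z) * qpoch_inf (q ^ Suc (Suc n) / z) q"
      using qpoch_inf_rec[OF q(1), of "q ^ Suc n / z"] by (simp add: Y_def mult_ac)
    have Y': "qpoch_inf (q ^ Suc n / (z * q)) q = (1 - q ^ n / z) * Y"
      using qpoch_inf_rec[OF q(1), of "q ^ n / z"] q by (simp add: Y_def mult_ac)
    have X': "qpoch_inf (z * q * q ^ Suc n) q = X"
      by (simp add: X_def mult_ac)
    have "q ^ (Suc n)\<^sup>2 = q * q ^ n\<^sup>2 * q ^ n * q ^ n"
      by (simp add: power2_eq_square power_add)
    then have WS: "W (Suc n) = (q * z\<^sup>2 - 1) * (q * q ^ n\<^sup>2 * q ^ n * q ^ n) * X * Y"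
      by (simp only: W_def U_def Y X_def) (simp only: mult_ac)
    show ?thesis
      unfolding WS unfolding W_def U_def X X' Y' Y_def[symmetric]
      using z by (simp add: field_simps power2_eq_square)
  qed
  have "(\<lambda>n. q ^ n) \<longlonglongrightarrow> 0"
    using q by (intro LIMSEQ_power_zero)
  then have "W \<longlonglongrightarrow> (q * z\<^sup>2 - 1) * (1 - 0 / z) * 0"
    unfolding W_def by (intro tendsto_intros summable_LIMSEQ_zero summ z q(1))
  then have "(\<lambda>n. W (Suc n) - W n) sums (0 - W 0)"
    by (intro telescope_sums) simp
  then have "(\<lambda>n. U (z * q) n - q * z\<^sup>2 * U z n) sums (- W 0)"
    by (simp add: step)
  moreover have "(\<lambda>n. U (z * q) n - q * z\<^sup>2 * U z n) sums (suminf (U (z * q)) - q * z\<^sup>2 * suminf (U z))"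
    by (intro sums_diff sums_mult summable_sums summ)
  ultimately have "suminf (U (z * q)) - q * z\<^sup>2 * suminf (U z) = - W 0"
    by (rule sums_unique2[symmetric])
  moreover have "- W 0 = (q * z - 1 / z) * theta q z"
    using z by (simp add: W_def U_def theta_def qpoch_inf_rec[OF q(1), of z] field_simps power2_eq_square)
  ultimately have "suminf (U (z * q)) = q * z\<^sup>2 * suminf (U z) + (q * z - 1 / z) * theta q z"
    by (simp add: diff_eq_eq)
  moreover have "cleared_rank q w = qpoch_inf q q * suminf (U w)" for w
    by (simp add: cleared_rank_def U_def)
  ultimately show ?thesis
    by (simp only:) (simp add: algebra_simps)
qed

text \<open>Under \<open>nz\<close> no finite product in a denominator vanishes, so each tail in
  \<open>cleared_rank\<close> is the full infinite product divided by its first \<open>n\<close>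
  factors.\<close>

lemma cleared_rank_eq:
  assumes q: "norm q < 1" and z: "z \<noteq> 0"
    and nz: "\<forall>k\<ge>1. z * q ^ k \<noteq> 1 \<and> q ^ k \<noteq> z"
  shows "cleared_rank q z = qpoch_inf (z * q) q * qpoch_inf (q / z) q * qpoch_inf q q * rank_gf z q"
proof -
  have nz0: "z * q * q ^ k \<noteq> 1" "q / z * q ^ k \<noteq> 1" for k
    using nz[rule_format, of "Suc k"] z by (simp_all add: mult.assoc)
  have nz1: "qpoch (z * q) q n \<noteq> 0" "qpoch (q / z) q n \<noteq> 0" for n
    using nz0 by (auto simp only: qpoch_eq_0_iff)
  have nz2: "qpoch_inf (z * q) q \<noteq> 0" "qpoch_inf (q / z) q \<noteq> 0"
    by (rule qpoch_inf_nonzero[OF q nz0(1)], rule qpoch_inf_nonzero[OF q nz0(2)])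
  define c where "c = qpoch_inf (z * q) q * qpoch_inf (q / z) q"
  define r where "r = (\<lambda>n. q ^ n\<^sup>2 / (qpoch (z * q) q n * qpoch (q / z) q n))"
  have eq: "q ^ n\<^sup>2 * (qpoch_inf (z * q ^ Suc n) q * qpoch_inf (q ^ Suc n / z) q) = c * r n" for n
    using nz1[of n] qpoch_inf_split[OF q, of "z * q" n] qpoch_inf_split[OF q, of "q / z" n]
    by (simp add: c_def r_def mult_ac)
  have "summable r"
    using summable_cleared_rank[OF q, of z] nz2 unfolding eq c_def
    by (subst (asm) summable_cmult_iff) auto
  then have "cleared_rank q z = qpoch_inf q q * (c * suminf r)"
    unfolding cleared_rank_def eq by (subst suminf_mult) auto
  then show ?thesis
    by (simp add: c_def r_def rank_gf_def mult_ac)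
qed


section \<open>Left-hand sides of the second to fourth identities with their poles cleared\<close>

lemma norm_power2_less_1: "norm q < 1 \<Longrightarrow> norm (q\<^sup>2 :: complex) < 1"
  by (simp add: norm_power power_less_one_iff)

lemma theta_reflect: "w \<noteq> 0 \<Longrightarrow> q \<noteq> 0 \<Longrightarrow> theta q (q / w) = theta q w"
  by (simp add: theta_def mult.commute)

text \<open>Left-hand side of the second identity. The powers of \<open>q\<close> in
  \<open>(zq;q)_inf\<close> and \<open>(q/z;q)_inf\<close> are split by parity: the even ones are
  contained in \<open>cleared_rank (q\<^sup>2) z\<close>, the odd ones form the theta factor. The
  quotient replaces \<open>(q^2;q^2)_inf\<close> by \<open>(q;q)_inf\<close>.\<close>

definition rank_theta_product2 :: "complex \<Rightarrow> complex \<Rightarrow> complex" where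
  "rank_theta_product2 q z = theta (q\<^sup>2) (z * q) * (qpoch_inf q q / qpoch_inf (q\<^sup>2) (q\<^sup>2)) * cleared_rank (q\<^sup>2) z"

text \<open>Left-hand side of the third identity. \<open>theta q (- z)\<close> supplies
  \<open>1 + z\<close> and, with the products inside \<open>cleared_rank\<close>, the even powers of
  \<open>q\<close> in \<open>(z^2 q;q)_inf\<close> and \<open>(q/z^2;q)_inf\<close>; the second
  theta factor supplies the odd ones.\<close>

definition rank_theta_product3 :: "complex \<Rightarrow> complex \<Rightarrow> complex" where
  "rank_theta_product3 q z = theta q (- z) * theta (q\<^sup>2) (z\<^sup>2 * q) * cleared_rank q z"

text \<open>Left-hand side of the fourth identity: only even powers of \<open>q\<close> occur there,
  so \<open>theta q (- z)\<close> suffices, and the quotient replaces \<open>(q;q)_inf\<close> by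
  \<open>(q^2;q^2)_inf\<close>.\<close>

definition rank_theta_product4 :: "complex \<Rightarrow> complex \<Rightarrow> complex" where
  "rank_theta_product4 q z = theta q (- z) * (qpoch_inf (q\<^sup>2) (q\<^sup>2) / qpoch_inf q q) * cleared_rank q z"

context
  fixes q :: complex
  assumes q: "norm q < 1" "q \<noteq> 0"
begin

lemma holomorphic_rank_theta_product2: "rank_theta_product2 q holomorphic_on (- {0})"
  unfolding rank_theta_product2_def[abs_def] using q norm_power2_less_1[OF q(1)]
  by (intro holomorphic_intros holomorphic_cleared_rank) auto

lemma holomorphic_rank_theta_product3: "rank_theta_product3 q holomorphic_on (- {0})"
  unfolding rank_theta_product3_def[abs_def] using q norm_power2_less_1[OF q(1)]
  by (intro holomorphic_intros holomorphic_cleared_rank) auto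

lemma holomorphic_rank_theta_product4: "rank_theta_product4 q holomorphic_on (- {0})"
  unfolding rank_theta_product4_def[abs_def] using q norm_power2_less_1[OF q(1)]
  by (intro holomorphic_intros holomorphic_cleared_rank) auto

lemma rank_theta_product2_mult:
  assumes z: "z \<noteq> 0"
  shows "rank_theta_product2 q (z * q\<^sup>2) = - q * z * rank_theta_product2 q z + (1 / (q * z\<^sup>2) - q) * (qpoch_inf q q * theta q z)"
proof -
  note q2 = norm_power2_less_1[OF q(1)]
  have P: "qpoch_inf (q\<^sup>2) (q\<^sup>2) \<noteq> 0" by (rule qpoch_inf_self_nonzero[OF q2])
  have 1: "theta (q\<^sup>2) (z * q\<^sup>2 * q) = - theta (q\<^sup>2) (z * q) / (z * q)"
    using theta_mult_q[OF q2, of "z * q"] q z by (simp add: mult_ac)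
  have 2: "cleared_rank (q\<^sup>2) (z * q\<^sup>2) = q\<^sup>2 * z\<^sup>2 * cleared_rank (q\<^sup>2) z
      + (q\<^sup>2 * z - 1 / z) * (qpoch_inf (q\<^sup>2) (q\<^sup>2) * theta (q\<^sup>2) z)"
    by (rule cleared_rank_mult_q) (use q q2 z in auto)
  show ?thesis
    unfolding rank_theta_product2_def 1 2 theta_even_odd[OF q z] using q z P
    by (simp add: field_simps power2_eq_square)
qed

lemma rank_theta_product3_mult:
  assumes z: "z \<noteq> 0"
  shows "rank_theta_product3 q (z * q) = - rank_theta_product3 q z / z + (1 / (q * z ^ 4) - 1 / z\<^sup>2) * (qpoch_inf q q * theta q (z\<^sup>2))"
proof -
  note q2 = norm_power2_less_1[OF q(1)]
  have 0: "theta q (- (z * q)) = theta q (- z) / z"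
    using theta_mult_q[OF q, of "- z"] z by simp
  have 1: "theta (q\<^sup>2) ((z * q)\<^sup>2 * q) = - theta (q\<^sup>2) (z\<^sup>2 * q) / (z\<^sup>2 * q)"
    using theta_mult_q[OF q2, of "z\<^sup>2 * q"] q z by (simp add: power_mult_distrib mult_ac)
  have 3: "theta q (z\<^sup>2) = theta q z * theta q (- z) * theta (q\<^sup>2) (z\<^sup>2 * q)"
    using theta_even_odd[OF q, of "z\<^sup>2"] theta_square[OF q(1)] z by simp
  show ?thesis
    unfolding rank_theta_product3_def 0 1 3 cleared_rank_mult_q[OF q z] using q z
    by (simp add: field_simps power2_eq_square power4_eq_xxxx)
qed

lemma rank_theta_product3_inverse:
  assumes z: "z \<noteq> 0"
  shows "rank_theta_product3 q (1 / z) = rank_theta_product3 q z / z"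
proof -
  have "theta q (- (1 / z)) = theta q (- z) / z"
    using theta_inverse[OF q(1), of "- z"] z by simp
  moreover have "theta (q\<^sup>2) ((1 / z)\<^sup>2 * q) = theta (q\<^sup>2) (z\<^sup>2 * q)"
    using theta_reflect[of "z\<^sup>2 * q" "q\<^sup>2"] q z by (simp add: power2_eq_square)
  ultimately show ?thesis
    by (simp add: rank_theta_product3_def cleared_rank_inverse)
qed

lemma rank_theta_product4_mult:
  assumes z: "z \<noteq> 0"
  shows "rank_theta_product4 q (z * q) = q * z * rank_theta_product4 q z + (q - 1 / z\<^sup>2) * (qpoch_inf (q\<^sup>2) (q\<^sup>2) * theta (q\<^sup>2) (z\<^sup>2))"
proof -
  have P: "qpoch_inf q q \<noteq> 0" by (rule qpoch_inf_self_nonzero[OF q(1)])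
  have 0: "theta q (- (z * q)) = theta q (- z) / z"
    using theta_mult_q[OF q, of "- z"] z by simp
  show ?thesis
    unfolding rank_theta_product4_def 0 theta_square[OF q(1)] cleared_rank_mult_q[OF q z] using z P
    by (simp add: field_simps power2_eq_square)
qed

lemma rank_theta_product2_eq:
  assumes z: "z \<noteq> 0" and nz: "\<forall>k\<ge>1. z * q ^ (2 * k) \<noteq> 1 \<and> q ^ (2 * k) \<noteq> z"
  shows "rank_theta_product2 q z = qpoch_inf (z * q) q * qpoch_inf (q / z) q * qpoch_inf q q * rank_gf z (q\<^sup>2)"
proof -
  note q2 = norm_power2_less_1[OF q(1)]
  have P: "qpoch_inf (q\<^sup>2) (q\<^sup>2) \<noteq> 0" by (rule qpoch_inf_self_nonzero[OF q2])
  have F: "cleared_rank (q\<^sup>2) z = qpoch_inf (z * q\<^sup>2) (q\<^sup>2) * qpoch_inf (q\<^sup>2 / z) (q\<^sup>2) * qpoch_inf (q\<^sup>2) (q\<^sup>2) * rank_gf z (q\<^sup>2)"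
    by (rule cleared_rank_eq[OF q2 z]) (use nz in \<open>simp add: power_mult\<close>)
  have "q\<^sup>2 / (z * q) = q / z"
    using q by (simp add: power2_eq_square)
  moreover have "qpoch_inf (z * q) q = qpoch_inf (z * q) (q\<^sup>2) * qpoch_inf (z * q\<^sup>2) (q\<^sup>2)"
    using qpoch_inf_even_odd[OF q(1), of "z * q"] by (simp add: power2_eq_square mult.assoc)
  moreover have "qpoch_inf (q / z) q = qpoch_inf (q / z) (q\<^sup>2) * qpoch_inf (q\<^sup>2 / z) (q\<^sup>2)"
    using qpoch_inf_even_odd[OF q(1), of "q / z"] by (simp add: power2_eq_square)
  ultimately show ?thesis
    using P by (simp add: rank_theta_product2_def F theta_def)
qed

lemma rank_theta_product3_eq:
  assumes z: "z \<noteq> 0" and nz: "\<forall>k\<ge>1. z * q ^ k \<noteq> 1 \<and> q ^ k \<noteq> z"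
  shows "rank_theta_product3 q z = (1 + z) * qpoch_inf (z\<^sup>2 * q) q * qpoch_inf (q / z\<^sup>2) q * qpoch_inf q q * rank_gf z q"
proof -
  have "q\<^sup>2 / (z\<^sup>2 * q) = q / z\<^sup>2" "z\<^sup>2 * q * q = (z * q)\<^sup>2" "q / z\<^sup>2 * q = (q / z)\<^sup>2"
    using q by (simp_all add: power2_eq_square)
  then show ?thesis
    using qpoch_inf_even_odd[OF q(1), of "z\<^sup>2 * q"] qpoch_inf_even_odd[OF q(1), of "q / z\<^sup>2"]
      qpoch_inf_square[OF q(1), of "z * q"] qpoch_inf_square[OF q(1), of "q / z"]
      theta_minus_factor[OF q(1), of z]
    by (simp add: rank_theta_product3_def cleared_rank_eq[OF q(1) z nz] theta_def[of "q\<^sup>2"])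
qed

lemma rank_theta_product4_eq:
  assumes z: "z \<noteq> 0" and nz: "\<forall>k\<ge>1. z * q ^ k \<noteq> 1 \<and> q ^ k \<noteq> z"
  shows "rank_theta_product4 q z = (1 + z) * qpoch_inf (z\<^sup>2 * q\<^sup>2) (q\<^sup>2) * qpoch_inf (q\<^sup>2 / z\<^sup>2) (q\<^sup>2) * qpoch_inf (q\<^sup>2) (q\<^sup>2) * rank_gf z q"
proof -
  have "(z * q)\<^sup>2 = z\<^sup>2 * q\<^sup>2" "(q / z)\<^sup>2 = q\<^sup>2 / z\<^sup>2"
    by (simp_all add: power2_eq_square)
  moreover have "qpoch_inf q q \<noteq> 0" by (rule qpoch_inf_self_nonzero[OF q(1)])
  ultimately show ?thesis
    using qpoch_inf_square[OF q(1), of "z * q"] qpoch_inf_square[OF q(1), of "q / z"]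
      theta_minus_factor[OF q(1), of z]
    by (simp add: rank_theta_product4_def cleared_rank_eq[OF q(1) z nz])
qed

end

section \<open>Lattice series and the Jacobi triple product\<close>

text \<open>The term is \<open>(R * r ^ n) ^ n\<close>, whose base tends to 0, so a geometric series
  of ratio \<open>1/2\<close> eventually dominates.\<close>

lemma summable_power_mult_power_square:
  fixes R r :: real
  assumes "0 \<le> R" "0 \<le> r" "r < 1"
  shows "summable (\<lambda>n::nat. R ^ n * r ^ n\<^sup>2)"
proof (rule summable_comparison_test_ev)
  have "(\<lambda>n. R * r ^ n) \<longlonglongrightarrow> R * 0"
    using assms by (intro tendsto_intros LIMSEQ_power_zero) auto
  then have "eventually (\<lambda>n. R * r ^ n < 1 / 2) sequentially"
    by (intro order_tendstoD(2)) auto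
  then show "eventually (\<lambda>n. norm (R ^ n * r ^ n\<^sup>2) \<le> (1 / 2) ^ n) sequentially"
  proof eventually_elim
    case (elim n)
    have "R ^ n * r ^ n\<^sup>2 = (R * r ^ n) ^ n"
      by (simp add: power_mult_distrib power2_eq_square power_mult)
    also have "\<dots> \<le> (1 / 2) ^ n"
      using elim assms by (intro power_mono) auto
    finally show ?case using assms by simp
  qed
qed (simp add: summable_geometric)

definition gauss_bound :: "real \<Rightarrow> real \<Rightarrow> int \<Rightarrow> real" where
  "gauss_bound R r k = R ^ nat \<bar>k\<bar> * r ^ (nat \<bar>k\<bar>)\<^sup>2"

lemma gauss_bound_nonneg: "0 \<le> R \<Longrightarrow> 0 \<le> r \<Longrightarrow> 0 \<le> gauss_bound R r k"
  by (simp add: gauss_bound_def)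

lemma summable_on_gauss_bound:
  assumes "0 \<le> R" "0 \<le> r" "r < 1"
  shows "gauss_bound R r summable_on UNIV"
proof -
  have *: "(\<lambda>n::nat. R ^ n * r ^ n\<^sup>2) summable_on UNIV"
    using summable_power_mult_power_square[OF assms] assms
    by (intro norm_summable_imp_summable_on) simp
  have "gauss_bound R r summable_on (int ` UNIV)"
    by (subst summable_on_reindex) (use * in \<open>auto simp: o_def gauss_bound_def\<close>)
  moreover have "gauss_bound R r summable_on ((\<lambda>n. - int n) ` UNIV)"
    by (subst summable_on_reindex) (use * in \<open>auto simp: o_def gauss_bound_def inj_on_def\<close>)
  ultimately have "gauss_bound R r summable_on (int ` UNIV \<union> (\<lambda>n. - int n) ` UNIV)"
    by (rule summable_on_union)
  also have "int ` UNIV \<union> (\<lambda>n. - int n) ` UNIV = UNIV"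
    by (auto simp: image_iff) (metis int_cases2)
  finally show ?thesis .
qed

lemma summable_on_gauss_bound_prod:
  assumes "0 \<le> R" "0 \<le> r" "r < 1"
  shows "(\<lambda>(n, j). gauss_bound R r n * gauss_bound R r j) summable_on UNIV"
proof -
  have "(\<lambda>(n, j). gauss_bound R r n * gauss_bound R r j) summable_on UNIV \<times> UNIV"
  proof (rule summable_on_SigmaI)
    show "((\<lambda>j. case (n, j) of (n, j) \<Rightarrow> gauss_bound R r n * gauss_bound R r j) has_sum
        gauss_bound R r n * infsum (gauss_bound R r) UNIV) UNIV" for n
      using has_sum_cmult_right[OF has_sum_infsum[OF summable_on_gauss_bound[OF assms]]] by simp
    show "(\<lambda>n. gauss_bound R r n * infsum (gauss_bound R r) UNIV) summable_on UNIV"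
      by (intro summable_on_cmult_left summable_on_gauss_bound assms)
  qed (auto simp: gauss_bound_nonneg assms)
  then show ?thesis by simp
qed

text \<open>Keeping the three exponents as separate integer arguments reduces every comparison of
  terms to arithmetic of exponents.\<close>

definition signed_monomial :: "complex \<Rightarrow> complex \<Rightarrow> int \<Rightarrow> int \<Rightarrow> int \<Rightarrow> complex" where
  "signed_monomial q z m a b = (-1) powi m * z powi a * q powi b"

text \<open>One pair of bounds for all the lattice series below. The factor 3 accommodates the
  exponent \<open>n - 3 * j + 1\<close>; 16 is a convenient common constant for the quadratic
  exponents. The added 16 allows an exponent such as \<open>triangular 1 = 0\<close> away from the
  origin.\<close>

locale lattice_series =
  fixes D :: "(int \<times> int) set" and m e E :: "int \<times> int \<Rightarrow> int"
  assumes e_bound: "\<And>n j. (n, j) \<in> D \<Longrightarrow> \<bar>e (n, j)\<bar> \<le> 3 * (\<bar>n\<bar> + \<bar>j\<bar> + 1)"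
    and E_bound: "\<And>n j. (n, j) \<in> D \<Longrightarrow> n\<^sup>2 + j\<^sup>2 \<le> 16 * E (n, j) + 16"
begin

definition summand :: "complex \<Rightarrow> complex \<Rightarrow> int \<times> int \<Rightarrow> complex" where
  "summand q z p = signed_monomial q z (m p) (e p) (E p)"

text \<open>The power of \<open>z\<close> grows at most exponentially and the power of
  \<open>q\<close> decays like a Gaussian, and both bounds separate into a factor for
  \<open>n\<close> and one for \<open>j\<close>. The additive constant in \<open>E_bound\<close>
  costs the factor \<open>1 / norm q\<close>.\<close>

lemma norm_summand_le:
  assumes q: "norm q < 1" "q \<noteq> 0" and z: "z \<noteq> 0" "norm z \<le> R" "norm (1 / z) \<le> R" and p: "(n, j) \<in> D"
  shows "norm (summand q z (n, j)) \<le>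
    R ^ 3 / norm q * (gauss_bound (R ^ 3) (norm q powr (1/16)) n * gauss_bound (R ^ 3) (norm q powr (1/16)) j)"
proof -
  define r where "r = norm q powr (1/16)"
  \<comment> \<open>Needed to enlarge the exponent of \<open>R\<close> below; it holds because
    \<open>z\<close> and \<open>1 / z\<close> cannot both have modulus below 1.\<close>
  have "1 \<le> R"
  proof (rule ccontr)
    assume "\<not> 1 \<le> R"
    then have "norm z < 1" "norm (1 / z) < 1" using z by auto
    then show False using z by (auto simp: norm_divide field_simps)
  qed
  have "norm (z powi e (n, j)) \<le> R ^ nat \<bar>e (n, j)\<bar>"
  proof (cases "e (n, j) \<ge> 0")
    case True
    then show ?thesis using z by (simp add: power_int_def norm_power power_mono)
  next
    case False
    then have "norm (z powi e (n, j)) = norm (1 / z) ^ nat \<bar>e (n, j)\<bar>"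
      by (simp add: power_int_def norm_power norm_divide norm_inverse inverse_eq_divide)
    then show ?thesis using z by (simp add: power_mono)
  qed
  also have "\<dots> \<le> R ^ (3 * (nat \<bar>n\<bar> + nat \<bar>j\<bar> + 1))"
    using e_bound[OF p] \<open>1 \<le> R\<close> by (intro power_increasing) (auto simp: nat_le_iff)
  also have "\<dots> = R ^ 3 * ((R ^ 3) ^ nat \<bar>n\<bar> * (R ^ 3) ^ nat \<bar>j\<bar>)"
    by (simp add: power_mult power_add)
  finally have 1: "norm (z powi e (n, j)) \<le> R ^ 3 * ((R ^ 3) ^ nat \<bar>n\<bar> * (R ^ 3) ^ nat \<bar>j\<bar>)" .
  have "norm (q powi E (n, j)) = norm q powr of_int (E (n, j))"
    using q by (simp add: norm_power_int powr_real_of_int')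
  also have "\<dots> \<le> norm q powr (of_int (n\<^sup>2 + j\<^sup>2) / 16 - 1)"
  proof (rule powr_mono')
    have "real_of_int (n\<^sup>2 + j\<^sup>2) \<le> of_int (16 * E (n, j) + 16)"
      using E_bound[OF p] by (simp only: of_int_le_iff)
    then show "of_int (n\<^sup>2 + j\<^sup>2) / 16 - 1 \<le> real_of_int (E (n, j))"
      by (simp add: field_simps)
  qed (use q in auto)
  also have "\<dots> = norm q powr (1/16 * real ((nat \<bar>n\<bar>)\<^sup>2 + (nat \<bar>j\<bar>)\<^sup>2)) / norm q"
    using q by (simp add: powr_diff)
  also have "\<dots> = (r ^ (nat \<bar>n\<bar>)\<^sup>2 * r ^ (nat \<bar>j\<bar>)\<^sup>2) / norm q"
    using q unfolding r_def powr_powr[symmetric] by (subst powr_realpow) (auto simp: power_add)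
  finally have 2: "norm (q powi E (n, j)) \<le> (r ^ (nat \<bar>n\<bar>)\<^sup>2 * r ^ (nat \<bar>j\<bar>)\<^sup>2) / norm q" .
  have "norm (summand q z (n, j)) \<le> 1 * (R ^ 3 * ((R ^ 3) ^ nat \<bar>n\<bar> * (R ^ 3) ^ nat \<bar>j\<bar>)) *
      ((r ^ (nat \<bar>n\<bar>)\<^sup>2 * r ^ (nat \<bar>j\<bar>)\<^sup>2) / norm q)"
    unfolding summand_def signed_monomial_def norm_mult using \<open>1 \<le> R\<close>
    by (intro mult_mono 1 2 mult_nonneg_nonneg) (auto simp: norm_power_int)
  then show ?thesis
    by (simp add: gauss_bound_def r_def mult_ac)
qed

lemma summable_on_bound:
  fixes q :: complex
  assumes "norm q < 1" "q \<noteq> 0" "0 \<le> R"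
  shows "(\<lambda>(n, j). R ^ 3 / norm q * (gauss_bound (R ^ 3) (norm q powr (1/16)) n *
    gauss_bound (R ^ 3) (norm q powr (1/16)) j)) summable_on D"
proof -
  have "norm q powr (1/16) < 1"
    using powr_less_mono2[of "1/16" "norm q" 1] assms by simp
  then have "(\<lambda>(n, j). gauss_bound (R ^ 3) (norm q powr (1/16)) n *
    gauss_bound (R ^ 3) (norm q powr (1/16)) j) summable_on D"
    using assms by (intro summable_on_subset[OF summable_on_gauss_bound_prod]) auto
  from summable_on_cmult_right[OF this, of "R ^ 3 / norm q"] show ?thesis
    by (simp add: case_prod_unfold)
qed

lemma summable_on_summand:
  assumes q: "norm q < 1" "q \<noteq> 0" and z: "z \<noteq> 0"
  shows "summand q z summable_on D"
proof -
  define R where "R = max (norm z) (norm (1 / z))"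
  have "0 \<le> R" by (simp add: R_def le_max_iff_disj)
  have "norm z \<le> R" "norm (1 / z) \<le> R" by (simp_all only: R_def max.cobounded1 max.cobounded2)
  then have "(\<lambda>p. norm (summand q z p)) summable_on D"
    using norm_summand_le[OF q z]
    by (intro Infinite_Sum.abs_summable_on_comparison_test'[OF summable_on_bound[OF q \<open>0 \<le> R\<close>]]) fast
  then show ?thesis by (rule Infinite_Sum.abs_summable_summable)
qed

text \<open>The Weierstrass test is applied along the net of finite subsets of \<open>D\<close>, so
  no enumeration of the lattice has to be chosen.\<close>

lemma holomorphic_lattice_series:
  assumes q: "norm q < 1" "q \<noteq> 0"
  shows "(\<lambda>z. infsum (summand q z) D) holomorphic_on (- {0})"
  unfolding holomorphic_on_def
proof
  fix x :: complex
  assume "x \<in> - {0}"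
  then have x: "x \<noteq> 0" by simp
  define R where "R = max (2 * norm x) (2 / norm x)"
  have "0 \<le> R" by (simp add: R_def le_max_iff_disj)
  have nz: "norm z \<ge> norm x / 2" "norm z \<le> 2 * norm x" if "z \<in> cball x (norm x / 2)" for z
    using that norm_triangle_ineq2[of z x] norm_triangle_ineq2[of x z]
    by (auto simp: dist_norm norm_minus_commute)
  have nz0: "norm z > 0" if "z \<in> cball x (norm x / 2)" for z
    using nz(1)[OF that] x by (smt (verit) divide_pos_pos zero_less_norm_iff)
  have lim: "uniform_limit (cball x (norm x / 2)) (\<lambda>X z. \<Sum>p\<in>X. summand q z p)
      (\<lambda>z. infsum (summand q z) D) (finite_subsets_at_top D)"
  proof (rule Weierstrass_m_test_general[OF _ summable_on_bound[OF q \<open>0 \<le> R\<close>]], clarify)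
    fix n j z
    assume p: "(n, j) \<in> D" and z: "z \<in> cball x (norm x / 2)"
    have "norm z \<le> R" "norm (1 / z) \<le> R"
      using nz[OF z] nz0[OF z] x by (auto simp: R_def norm_divide le_max_iff_disj field_simps)
    then show "norm (summand q z (n, j)) \<le> R ^ 3 / norm q *
        (gauss_bound (R ^ 3) (norm q powr (1/16)) n * gauss_bound (R ^ 3) (norm q powr (1/16)) j)"
      using p nz0[OF z] by (intro norm_summand_le q) auto
  qed
  have hol: "(\<lambda>z. \<Sum>p\<in>X. summand q z p) holomorphic_on - {0}" for X
    unfolding summand_def signed_monomial_def by (intro holomorphic_intros) auto
  have sub: "cball x (norm x / 2) \<subseteq> - {0}"
    using nz0 by force
  have "eventually (\<lambda>X. continuous_on (cball x (norm x / 2)) (\<lambda>z. \<Sum>p\<in>X. summand q z p) \<and>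
      (\<lambda>z. \<Sum>p\<in>X. summand q z p) holomorphic_on ball x (norm x / 2)) (finite_subsets_at_top D)"
    using holomorphic_on_imp_continuous_on[OF holomorphic_on_subset[OF hol sub]]
      holomorphic_on_subset[OF hol order_trans[OF ball_subset_cball sub]]
    by (simp add: always_eventually)
  then have "(\<lambda>z. infsum (summand q z) D) holomorphic_on ball x (norm x / 2)"
    by (rule holomorphic_uniform_limit[OF _ lim finite_subsets_at_top_neq_bot])
  then have "(\<lambda>z. infsum (summand q z) D) field_differentiable at x"
    by (rule holomorphic_on_imp_differentiable_at) (use x in auto)
  then show "(\<lambda>z. infsum (summand q z) D) field_differentiable at x within - {0}"
    by (rule field_differentiable_at_within)
qed

end

section \<open>Gaussian binomial coefficients and the triple product\<close>

fun qbinom :: "complex \<Rightarrow> nat \<Rightarrow> nat \<Rightarrow> complex" where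
  "qbinom q n 0 = 1"
| "qbinom q 0 (Suc k) = 0"
| "qbinom q (Suc n) (Suc k) = qbinom q n (Suc k) + q ^ (n - k) * qbinom q n k"

lemma qbinom_eq_0: "n < k \<Longrightarrow> qbinom q n k = 0"
  by (induction q n k rule: qbinom.induct) auto

lemma qbinom_self [simp]: "qbinom q n n = 1"
  by (induction n) (simp_all add: qbinom_eq_0)

text \<open>The closed form of the Gaussian binomial, free of division. With
  \<open>n = Suc (k + d)\<close> the recursion matches the splitting
  \<open>1 - q^(n+1) = (1 - q^(d+1)) + q^(d+1) (1 - q^(k+1))\<close>.\<close>

lemma qbinom_mult_qpoch:
  "k \<le> n \<Longrightarrow> qbinom q n k * (qpoch q q k * qpoch q q (n - k)) = qpoch q q n"
proof (induction q n k rule: qbinom.induct)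
  case (3 q n k)
  show ?case
  proof (cases "k = n")
    case False
    then have "k < n" using 3 by simp
    then obtain d where n: "n = Suc (k + d)" by (metis less_iff_Suc_add)
    have 1: "qbinom q n (Suc k) * (qpoch q q (Suc k) * qpoch q q d) = qpoch q q n"
      and 2: "qbinom q n k * (qpoch q q k * qpoch q q (Suc d)) = qpoch q q n"
      using 3 n by (simp_all add: Suc_diff_le)
    have "qbinom q (Suc n) (Suc k) * (qpoch q q (Suc k) * qpoch q q (Suc n - Suc k)) =
        (qbinom q n (Suc k) * (qpoch q q (Suc k) * qpoch q q d)) * (1 - q ^ Suc d)
      + q ^ Suc d * (qbinom q n k * (qpoch q q k * qpoch q q (Suc d))) * (1 - q ^ Suc k)"
      by (simp add: n qpoch_Suc algebra_simps)
    also have "\<dots> = qpoch q q (Suc n)"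
      unfolding 1 2 by (simp add: n qpoch_Suc power_add algebra_simps)
    finally show ?thesis .
  qed (simp add: qbinom_eq_0)
qed auto

fun tri :: "nat \<Rightarrow> nat" where
  "tri 0 = 0"
| "tri (Suc k) = tri k + k"

lemma int_tri: "2 * int (tri k) = int k * (int k - 1)"
  by (induction k) (simp_all add: algebra_simps)

text \<open>The finite q-binomial theorem. Multiplying by the factor \<open>1 - x * q ^ n\<close>
  reproduces the Pascal recursion of \<open>qbinom\<close> coefficient by coefficient.\<close>

lemma qpoch_expansion:
  "qpoch x q n = (\<Sum>k\<le>n. (-1) ^ k * q ^ tri k * x ^ k * qbinom q n k)"
proof (induction n)
  case (Suc n)
  define c where "c = (\<lambda>k. (-1) ^ k * q ^ tri k * x ^ k)"
  have c: "c (Suc k) * q ^ (n - k) = - (c k * x * q ^ n)" if "k \<le> n" for k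
  proof -
    have "q ^ n = q ^ k * q ^ (n - k)" using that by (simp flip: power_add)
    then show ?thesis by (simp add: c_def power_add)
  qed
  have "qpoch x q (Suc n) = (\<Sum>k\<le>n. c k * qbinom q n k) * (1 - x * q ^ n)"
    by (simp add: qpoch_Suc Suc.IH c_def)
  also have "\<dots> = (\<Sum>k\<le>n. c k * qbinom q n k) + (\<Sum>k\<le>n. - (c k * x * q ^ n) * qbinom q n k)"
    unfolding sum.distrib[symmetric] sum_distrib_right
    by (intro sum.cong refl) (simp add: algebra_simps)
  also have "(\<Sum>k\<le>n. c k * qbinom q n k) = (\<Sum>k\<le>Suc n. c k * qbinom q n k)"
    by (simp add: qbinom_eq_0)
  also have "\<dots> = c 0 + (\<Sum>k\<le>n. c (Suc k) * qbinom q n (Suc k))"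
    by (subst sum.atMost_Suc_shift) simp
  also have "(\<Sum>k\<le>n. - (c k * x * q ^ n) * qbinom q n k) = (\<Sum>k\<le>n. c (Suc k) * q ^ (n - k) * qbinom q n k)"
    by (intro sum.cong refl) (simp add: c)
  also have "c 0 + (\<Sum>k\<le>n. c (Suc k) * qbinom q n (Suc k)) + (\<Sum>k\<le>n. c (Suc k) * q ^ (n - k) * qbinom q n k)
     = c 0 + (\<Sum>k\<le>n. c (Suc k) * qbinom q (Suc n) (Suc k))"
    by (simp add: sum.distrib algebra_simps)
  also have "\<dots> = (\<Sum>k\<le>Suc n. c k * qbinom q (Suc n) k)"
    by (subst sum.atMost_Suc_shift) simp
  finally show ?case by (simp add: c_def)
qed simp

text \<open>Each factor \<open>1 - z / q^i\<close> with \<open>1 \<le> i \<le> n\<close> equals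
  \<open>- (z / q^i) (1 - q^i / z)\<close>; the powers of \<open>q\<close> collect to
  \<open>tri (Suc n) = n (n + 1) / 2\<close>.\<close>

lemma qpoch_reverse:
  assumes "q \<noteq> 0" "z \<noteq> 0"
  shows "qpoch (z / q ^ n) q n * q ^ tri (Suc n) = (-1) ^ n * z ^ n * qpoch (q / z) q n"
proof (induction n)
  case (Suc n)
  have "qpoch (z / q ^ Suc n) q (Suc n) = (1 - z / q ^ Suc n) * qpoch (z / q ^ n) q n"
    using qpoch_add[of "z / q ^ Suc n" q 1 n] assms by (simp add: qpoch_def)
  then have "qpoch (z / q ^ Suc n) q (Suc n) * q ^ tri (Suc (Suc n))
    = (1 - z / q ^ Suc n) * q ^ Suc n * (qpoch (z / q ^ n) q n * q ^ tri (Suc n))"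
    by (simp add: power_add)
  also have "\<dots> = (-1) ^ Suc n * z ^ Suc n * qpoch (q / z) q (Suc n)"
    unfolding Suc.IH using assms by (simp add: qpoch_Suc field_simps)
  finally show ?case .
qed simp

definition triangular :: "int \<Rightarrow> int" where
  "triangular k = k * (k - 1) div 2"

lemma two_triangular: "2 * triangular k = k * (k - 1)"
  by (simp add: triangular_def)

definition theta_term :: "complex \<Rightarrow> complex \<Rightarrow> int \<Rightarrow> complex" where
  "theta_term q z k = signed_monomial q z k k (triangular k)"

text \<open>The q-binomial theorem for the \<open>2 * N\<close> consecutive factors starting at
  \<open>z / q ^ N\<close>, with the first half reversed and the summation index recentred by
  \<open>m = k - N\<close>.\<close>

lemma finite_triple_product:
  assumes "q \<noteq> 0" "z \<noteq> 0"
  shows "qpoch z q N * qpoch (q / z) q N =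
    (\<Sum>m\<in>{- int N..int N}. theta_term q z m * qbinom q (2 * N) (nat (int N + m)))"
proof -
  define c where "c = (-1) ^ N * q ^ tri (Suc N) / z ^ N"
  have "qpoch z q N * qpoch (q / z) q N = c * qpoch (z / q ^ N) q (2 * N)"
  proof -
    have "qpoch (z / q ^ N) q (2 * N) = qpoch (z / q ^ N) q N * qpoch z q N"
      using qpoch_add[of "z / q ^ N" q N N] assms by (simp add: mult_2)
    then have "c * qpoch (z / q ^ N) q (2 * N)
        = (-1) ^ N / z ^ N * (qpoch (z / q ^ N) q N * q ^ tri (Suc N)) * qpoch z q N"
      by (simp add: c_def)
    also have "\<dots> = ((-1) ^ N * (-1) ^ N) * (z ^ N / z ^ N) * qpoch z q N * qpoch (q / z) q N"
      unfolding qpoch_reverse[OF assms] by simp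
    also have "\<dots> = qpoch z q N * qpoch (q / z) q N"
      using assms by (simp flip: power_mult_distrib)
    finally show ?thesis ..
  qed
  also have "\<dots> = (\<Sum>k\<le>2 * N. c * ((-1) ^ k * q ^ tri k * (z / q ^ N) ^ k * qbinom q (2 * N) k))"
    by (simp add: qpoch_expansion sum_distrib_left)
  also have "\<dots> = (\<Sum>m\<in>{- int N..int N}. theta_term q z m * qbinom q (2 * N) (nat (int N + m)))"
  proof (rule sum.reindex_bij_witness[of _ "\<lambda>m. nat (int N + m)" "\<lambda>k. int k - int N"])
    fix k assume "k \<in> {..2 * N}"
    define m where "m = int k - int N"
    have "2 * (int (tri (Suc N)) + int (tri k) - int N * int k) = m * (m - 1)"
      using int_tri[of "Suc N"] int_tri[of k] by (simp add: m_def algebra_simps)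
    then have t: "triangular m = int (tri (Suc N)) + int (tri k) - int N * int k"
      using two_triangular[of m] by simp
    have "theta_term q z m = c * ((-1) ^ k * q ^ tri k * (z / q ^ N) ^ k)"
      using assms unfolding theta_term_def signed_monomial_def t
      by (simp add: m_def c_def power_int_diff power_int_add power_int_of_nat power_divide
          minus_one_power_iff power_add flip: power_mult of_nat_mult)
    then show "theta_term q z (int k - int N) * qbinom q (2 * N) (nat (int N + (int k - int N))) =
        c * ((-1) ^ k * q ^ tri k * (z / q ^ N) ^ k * qbinom q (2 * N) k)"
      by (simp add: m_def)
  qed auto
  finally show ?thesis .
qed

text \<open>The majorant for the passage to the limit in the finite triple product. The inverses of
  \<open>qpoch q q n\<close> are bounded because they converge, the limit of
  \<open>qpoch q q n\<close> being nonzero.\<close>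

lemma qbinom_bounded:
  assumes "norm q < 1"
  shows "\<exists>C. \<forall>n k. norm (qbinom q n k) \<le> C"
proof -
  have nz: "qpoch q q n \<noteq> 0" for n
    by (rule qpoch_self_nonzero[OF assms])
  have "(\<lambda>n. inverse (qpoch q q n)) \<longlonglongrightarrow> inverse (qpoch_inf q q)"
    by (intro tendsto_inverse qpoch_LIMSEQ qpoch_inf_self_nonzero assms)
  then obtain D where D: "\<And>n. norm (inverse (qpoch q q n)) \<le> D"
    by (metis convergentI convergent_imp_Bseq BseqE)
  define B where "B = exp (norm q / (1 - norm q))"
  have "norm (qbinom q n k) \<le> max 0 (B * (D * D))" for n k
  proof (cases "k \<le> n")
    case True
    have "qbinom q n k = qpoch q q n * (inverse (qpoch q q k) * inverse (qpoch q q (n - k)))"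
      using qbinom_mult_qpoch[OF True, of q] nz by (simp add: field_simps)
    also have "norm \<dots> \<le> B * (D * D)"
      unfolding norm_mult B_def
      by (intro mult_mono norm_qpoch_le assms D) (auto intro: order_trans[OF norm_ge_zero D])
    finally show ?thesis by simp
  qed (simp add: qbinom_eq_0)
  then show ?thesis by blast
qed

text \<open>The theta series regarded as a lattice series on the axis \<open>j = 0\<close>, which
  yields its summability.\<close>

interpretation theta_lattice: lattice_series "UNIV \<times> {0}" fst fst "\<lambda>p. triangular (fst p)"
proof
  show "n\<^sup>2 + j\<^sup>2 \<le> 16 * triangular (fst (n, j)) + 16"
    if "(n, j) \<in> UNIV \<times> {0}" for n j :: int
  proof -
    \<comment> \<open>Completes the square: the claim is \<open>0 \<le> 7 n^2 - 8 n + 16\<close>,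
      and 7 times the right-hand side is \<open>(7 n - 4)^2 + 96\<close>.\<close>
    have "0 \<le> (7 * n - 4)\<^sup>2" by simp
    then show ?thesis
      using that two_triangular[of n] by (simp add: power2_eq_square algebra_simps)
  qed
qed auto

lemma summable_on_theta_term:
  assumes "norm q < 1" "q \<noteq> 0" "z \<noteq> 0"
  shows "theta_term q z summable_on UNIV"
proof -
  have "theta_lattice.summand q z summable_on ((\<lambda>k. (k, 0)) ` UNIV)"
    by (rule summable_on_subset[OF theta_lattice.summable_on_summand[OF assms]]) auto
  then show ?thesis
    by (subst (asm) summable_on_reindex)
       (auto simp: inj_on_def o_def theta_lattice.summand_def theta_term_def[abs_def])
qed

text \<open>Tannery's theorem for the finite form as \<open>N\<close> grows: each recentred Gaussian
  binomial tends to \<open>1 / (q;q)_inf\<close>, and the terms are dominated by a multiple of the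
  theta series.\<close>

theorem jacobi_triple_product:
  assumes q: "norm q < 1" "q \<noteq> 0" and z: "z \<noteq> 0"
  shows "(theta_term q z has_sum (qpoch_inf q q * theta q z)) UNIV"
proof -
  obtain C where C: "\<And>n k. norm (qbinom q n k) \<le> C"
    using qbinom_bounded[OF q(1)] by blast
  \<comment> \<open>Extension by 0 outside \<open>\<bar>m\<bar> \<le> N\<close> makes the finite
    sums range over all integers; \<open>int_decode\<close> then turns them into series indexed by
    naturals, as Tannery's theorem expects.\<close>
  define b where "b = (\<lambda>m N. if \<bar>m\<bar> \<le> int N then qbinom q (2 * N) (nat (int N + m)) else 0)"
  define a where "a = (\<lambda>k N. theta_term q z (int_decode k) * b (int_decode k) N)"
  define P where "P = qpoch_inf q q"
  have P: "P \<noteq> 0" unfolding P_def by (rule qpoch_inf_self_nonzero[OF q(1)])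
  have bij: "bij_betw int_decode UNIV UNIV"
    using inj_int_decode surj_int_decode by (simp add: bij_betw_def)
  have lim: "(\<lambda>N. b m N) \<longlonglongrightarrow> inverse P" for m
  proof -
    have nz: "qpoch q q n \<noteq> 0" for n
      by (rule qpoch_self_nonzero[OF q(1)])
    have sub: "(\<lambda>N. qpoch q q (f N)) \<longlonglongrightarrow> P" if "filterlim f at_top sequentially" for f
      unfolding P_def by (rule filterlim_compose[OF qpoch_LIMSEQ[OF q(1)] that])
    have "(\<lambda>N. qpoch q q (2 * N) / (qpoch q q (nat (int N + m)) * qpoch q q (nat (int N - m)))) \<longlonglongrightarrow> P / (P * P)"
      by (intro tendsto_intros sub P no_zero_divisors; real_asymp)
    moreover have "eventually (\<lambda>N. qpoch q q (2 * N) / (qpoch q q (nat (int N + m)) * qpoch q q (nat (int N - m))) = b m N) sequentially"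
    proof (rule eventually_mono[OF eventually_ge_at_top[of "nat \<bar>m\<bar>"]])
      fix N assume N: "nat \<bar>m\<bar> \<le> N"
      then have "nat (int N + m) \<le> 2 * N" "2 * N - nat (int N + m) = nat (int N - m)" by auto
      then show "qpoch q q (2 * N) / (qpoch q q (nat (int N + m)) * qpoch q q (nat (int N - m))) = b m N"
        using qbinom_mult_qpoch[of "nat (int N + m)" "2 * N" q] nz N
        by (simp add: b_def field_simps)
    qed
    ultimately show ?thesis
      using P by (simp add: tendsto_cong inverse_eq_divide)
  qed
  have summ: "theta_term q z summable_on UNIV"
    by (rule summable_on_theta_term[OF q z])
  then have "(\<lambda>m. norm (theta_term q z m)) summable_on UNIV"
    by (simp add: summable_on_iff_abs_summable_on_complex)
  then have "(\<lambda>k. norm (theta_term q z (int_decode k))) summable_on UNIV"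
    by (subst summable_on_reindex_bij_betw[OF bij])
  then have summ': "summable (\<lambda>k. norm (theta_term q z (int_decode k)) * C)"
    by (intro summable_mult2 summable_on_imp_summable)
  have "eventually (\<lambda>n. summable (\<lambda>k. norm (a k n))) sequentially \<and>
           summable (\<lambda>k. norm (theta_term q z (int_decode k) * inverse P)) \<and>
           ((\<lambda>n. suminf (\<lambda>k. a k n)) \<longlonglongrightarrow> (\<Sum>k. theta_term q z (int_decode k) * inverse P))"
  proof (rule tannerys_theorem[OF _ _ summ'])
    show "(\<lambda>n. a k n) \<longlonglongrightarrow> theta_term q z (int_decode k) * inverse P" for k
      unfolding a_def by (intro tendsto_intros lim)
    have "norm (a k n) \<le> norm (theta_term q z (int_decode k)) * C" for k n
      using C[of "2 * n"] order_trans[OF norm_ge_zero C]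
      by (auto simp: a_def b_def norm_mult intro!: mult_left_mono)
    then show "\<forall>\<^sub>F (k, n) in sequentially \<times>\<^sub>F sequentially. norm (a k n) \<le> norm (theta_term q z (int_decode k)) * C"
      by (simp add: always_eventually)
  qed auto
  moreover have "suminf (\<lambda>k. a k N) = qpoch z q N * qpoch (q / z) q N" for N
  proof -
    have "((\<lambda>m. theta_term q z m * b m N) has_sum (qpoch z q N * qpoch (q / z) q N)) UNIV"
      by (rule has_sum_finite_neutralI[of "{- int N..int N}"])
         (auto simp: b_def finite_triple_product[OF q(2) z] intro!: sum.cong)
    then have "((\<lambda>k. a k N) has_sum (qpoch z q N * qpoch (q / z) q N)) UNIV"
      unfolding a_def by (subst has_sum_reindex_bij_betw[OF bij])
    then show ?thesis by (intro sums_unique[symmetric] has_sum_imp_sums)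
  qed
  moreover have "(\<Sum>k. theta_term q z (int_decode k) * inverse P) = infsum (theta_term q z) UNIV * inverse P"
  proof -
    have "((\<lambda>k. theta_term q z (int_decode k) * inverse P) has_sum (infsum (theta_term q z) UNIV * inverse P)) UNIV"
      by (intro has_sum_cmult_left, subst has_sum_reindex_bij_betw[OF bij], rule has_sum_infsum[OF summ])
    then show ?thesis by (intro sums_unique[symmetric] has_sum_imp_sums)
  qed
  ultimately have "(\<lambda>N. qpoch z q N * qpoch (q / z) q N) \<longlonglongrightarrow> infsum (theta_term q z) UNIV * inverse P"
    by simp
  moreover have "(\<lambda>N. qpoch z q N * qpoch (q / z) q N) \<longlonglongrightarrow> theta q z"
    unfolding theta_def by (intro tendsto_intros qpoch_LIMSEQ q)
  ultimately have "theta q z = infsum (theta_term q z) UNIV * inverse P"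
    by (rule LIMSEQ_unique[rotated])
  then have "infsum (theta_term q z) UNIV = P * theta q z"
    using P by (simp add: field_simps)
  then show ?thesis
    using has_sum_infsum[OF summ] by (simp add: P_def)
qed

section \<open>The difference equations of the double series\<close>

text \<open>\<open>k\<close>, \<open>i\<close>, \<open>j\<close> are the offsets between the
  exponents of -1, \<open>z\<close> and \<open>q\<close>; \<open>k\<close> matters only modulo 2. In
  the applications below, case 5 is the equation between the exponents of \<open>q\<close>, proved
  after doubling to remove the divisions by 2.\<close>

lemma signed_monomial_eqI:
  assumes "q \<noteq> 0" "z \<noteq> 0" "even (m - m' - k)" "a = a' + i" "b = b' + j"
    and "c * ((-1) powi k * z powi i * q powi j) = c'"
  shows "c * signed_monomial q z m a b = c' * signed_monomial q z m' a' b'"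
proof -
  have "(-1 :: complex) powi m = (-1) powi (m' + k) * (-1) powi (m - m' - k)"
    by (simp flip: power_int_add)
  also have "(-1 :: complex) powi (m - m' - k) = 1"
    using assms(3) by (auto simp: power_int_minus_left)
  finally show ?thesis
    using assms(1,2) unfolding assms(4,5) assms(6)[symmetric] signed_monomial_def
    by (simp add: power_int_add)
qed

lemma signed_monomial_mult_q:
  assumes "q \<noteq> 0"
  shows "signed_monomial q (z * q) m a b = signed_monomial q z m a (b + a)"
  using assms by (simp add: signed_monomial_def power_int_mult_distrib power_int_add)

lemma signed_monomial_mult_q2:
  assumes "q \<noteq> 0"
  shows "signed_monomial q (z * q\<^sup>2) m a b = signed_monomial q z m a (b + 2 * a)"
  using assms by (simp add: signed_monomial_def power_int_mult_distrib power_int_add power_int_mult)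

lemma signed_monomial_inverse:
  "signed_monomial q (1 / z) m a b = signed_monomial q z m (- a) b"
  by (simp add: signed_monomial_def power_int_minus power_int_divide_distrib inverse_eq_divide)

lemma double_eqI: "2 * x = 2 * y \<Longrightarrow> x = (y :: int)"
  by simp

text \<open>The numerator is always even, so \<open>div\<close> is exact. The exponents with
  \<open>+ j\<close> are \<open>hecke n (- j)\<close>.\<close>

definition hecke :: "int \<Rightarrow> int \<Rightarrow> int" where
  "hecke n j = (n\<^sup>2 - 3 * j\<^sup>2 + n - j) div 2"

lemma two_hecke: "2 * hecke n j = n\<^sup>2 - 3 * j\<^sup>2 + n - j"
proof -
  have "even (n\<^sup>2 - 3 * j\<^sup>2 + n - j)"
    by (cases "even n"; cases "even j") simp_all
  then show ?thesis by (simp add: hecke_def)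
qed

definition pent :: "int \<Rightarrow> int" where
  "pent n = n * (3 * n + 1) div 2"

lemma two_pent: "2 * pent n = n * (3 * n + 1)"
proof -
  have "even (n * (3 * n + 1))"
    by (cases "even n") simp_all
  then show ?thesis by (simp add: pent_def)
qed

text \<open>The form \<open>n^2 - 3 j^2\<close> is indefinite, but on this cone
  \<open>4 j^2 \<le> n^2\<close> makes it positive definite, and \<open>n - j\<close> is
  nonnegative.\<close>

lemma hecke_lower_bound:
  assumes "2 * \<bar>j\<bar> \<le> n"
  shows "n\<^sup>2 + j\<^sup>2 \<le> 16 * hecke n j"
proof -
  have "(2 * \<bar>j\<bar>)\<^sup>2 \<le> n\<^sup>2"
    using assms by (intro power_mono) auto
  then have "4 * j\<^sup>2 \<le> n\<^sup>2"
    by (simp add: power_mult_distrib)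
  then show ?thesis
    using two_hecke[of n j] assms zero_le_power2[of n] by linarith
qed

lemma hecke_minus_lower_bound:
  assumes "2 * \<bar>j\<bar> \<le> n"
  shows "n\<^sup>2 + j\<^sup>2 \<le> 16 * hecke n (- j)"
  using hecke_lower_bound[of "- j" n] assms by simp

lemma infsum_mult_reindex:
  fixes f :: "'a \<Rightarrow> complex"
  assumes "\<And>k. k \<in> K \<Longrightarrow> i (g k) = k" "\<And>k. k \<in> K \<Longrightarrow> g k \<in> S"
    "\<And>p. p \<in> S \<Longrightarrow> g (i p) = p" "\<And>p. p \<in> S \<Longrightarrow> i p \<in> K"
    "\<And>k. k \<in> K \<Longrightarrow> X k = c * f (g k)"
  shows "c * infsum f S = infsum X K"
proof -
  have "infsum X K = infsum (\<lambda>p. c * f p) S"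
    by (rule infsum_reindex_bij_witness[of _ i g]) (use assms in auto)
  then show ?thesis
    by (simp add: infsum_cmult_right')
qed

text \<open>
  The shift \<open>g\<close> maps the domain \<open>D\<close> onto \<open>D'\<close>, which gains the points of \<open>P\<close> and loses those of \<open>M\<close>.
\<close>

lemma infsum_shift:
  fixes f f' :: "'a \<Rightarrow> complex"
  assumes D: "f summable_on D" and D': "f' summable_on D" and c: "c \<noteq> 0"
    and "\<And>p. p \<in> D \<Longrightarrow> i (g p) = p" "\<And>p. p \<in> D \<Longrightarrow> g p \<in> D'"
    "\<And>p. p \<in> D' \<Longrightarrow> g (i p) = p" "\<And>p. p \<in> D' \<Longrightarrow> i p \<in> D"
    "\<And>p. p \<in> D \<Longrightarrow> f' p = c * f (g p)"
    and sets: "D' \<union> M = D \<union> P" "D' \<inter> M = {}" "D \<inter> P = {}" "M \<subseteq> D" "P \<subseteq> D'"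
  shows "f summable_on D' \<and> infsum f' D = c * (infsum f D + infsum f P - infsum f M)"
proof -
  have "(\<lambda>p. c * f p) summable_on D'"
    using D' by (subst (asm) summable_on_reindex_bij_witness[of _ i g D' "\<lambda>p. c * f p"]) (use assms in auto)
  then have S: "f summable_on D'"
    using c by (simp add: summable_on_cmult_right')
  have "infsum f D' + infsum f M = infsum f (D' \<union> M)"
    using sets by (intro infsum_Un_disjoint[symmetric] S summable_on_subset[OF D]) auto
  also have "\<dots> = infsum f D + infsum f P"
    unfolding sets(1) using sets by (intro infsum_Un_disjoint D summable_on_subset[OF S]) auto
  finally have "infsum f D' = infsum f D + infsum f P - infsum f M"
    by (simp add: algebra_simps)
  moreover have "infsum f' D = infsum (\<lambda>p. c * f p) D'"
    by (rule infsum_reindex_bij_witness[of _ i g]) (use assms in auto)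
  ultimately show ?thesis
    using S by (simp add: infsum_cmult_right')
qed

lemma infsum_int_split:
  fixes X :: "int \<Rightarrow> complex"
  assumes "X summable_on UNIV"
  shows "infsum X UNIV = infsum X {..k} + infsum X {k + 1..}"
proof -
  have "infsum X ({..k} \<union> {k + 1..}) = infsum X {..k} + infsum X {k + 1..}"
    by (intro infsum_Un_disjoint summable_on_subset[OF assms]) auto
  moreover have "{..k} \<union> {k + 1..} = UNIV" by auto
  ultimately show ?thesis by simp
qed

lemma infsum_int_split_insert:
  fixes X :: "int \<Rightarrow> complex"
  assumes "X summable_on UNIV"
  shows "infsum X {k..} = X k + infsum X {k + 1..}"
proof -
  have "infsum X (insert k {k + 1..}) = X k + infsum X {k + 1..}"
    by (intro infsum_insert summable_on_subset[OF assms]) auto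
  moreover have "insert k {k + 1..} = {k..}" by auto
  ultimately show ?thesis by simp
qed

lemma theta_term_shift_has_sum:
  assumes "norm q < 1" "q \<noteq> 0" "z \<noteq> 0"
  shows "((\<lambda>k. c * theta_term q z (k + i)) has_sum (c * (qpoch_inf q q * theta q z))) UNIV"
proof -
  have "bij_betw (\<lambda>k. k + i) UNIV UNIV"
    by (rule bij_betwI[of _ _ _ "\<lambda>k. k - i"]) auto
  from has_sum_reindex_bij_betw[OF this, of "theta_term q z"] show ?thesis
    using jacobi_triple_product[OF assms] by (intro has_sum_cmult_right) auto
qed

section \<open>The double series of the first identity\<close>

interpretation s1a: lattice_series "{(n, j). 0 \<le> j \<and> 2 * j \<le> n}"
  "\<lambda>(n, j). n + j" "\<lambda>(n, j). n - 3 * j" "\<lambda>(n, j). hecke n j"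
  by unfold_locales (auto intro: order_trans[OF hecke_lower_bound])

interpretation s1b: lattice_series "{(n, j). 1 \<le> j \<and> 2 * j \<le> n}"
  "\<lambda>(n, j). n + j" "\<lambda>(n, j). n - 3 * j + 1" "\<lambda>(n, j). hecke n (- j)"
  by unfold_locales (auto intro: order_trans[OF hecke_minus_lower_bound])

text \<open>
  This is the part of the first double series with the powers \<open>n - 3 * j\<close> and \<open>n - 3 * j + 1\<close> of \<open>z\<close>;
  the other part is its value at \<open>1 / z\<close>, which turns out to be the same.
\<close>

definition hecke_series1 :: "complex \<Rightarrow> complex \<Rightarrow> complex" where
  "hecke_series1 q z = infsum (s1a.summand q z) {(n, j). 0 \<le> j \<and> 2 * j \<le> n}
    + infsum (s1b.summand q z) {(n, j). 1 \<le> j \<and> 2 * j \<le> n}"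

text \<open>
  In this and the three analogous proofs below, \<open>X\<close> and \<open>Y\<close> are the two shifted theta series that
  make up the inhomogeneous term; each boundary ray contributes a half-line of one of them.
\<close>

lemma hecke_series1_mult_q:
  assumes q: "norm q < 1" "q \<noteq> 0" and z: "z \<noteq> 0"
  shows "hecke_series1 q (z * q) = q * z\<^sup>2 * hecke_series1 q z + (q * z - 1 / z) * (qpoch_inf q q * theta q z)"
proof -
  have zq: "z * q \<noteq> 0" using q z by simp
  define X where "X = (\<lambda>k. q * z * theta_term q z (k + - 1))"
  define Y where "Y = (\<lambda>k. - (1 / z) * theta_term q z (k + 1))"
  have X: "(X has_sum (q * z * (qpoch_inf q q * theta q z))) UNIV"
    unfolding X_def by (rule theta_term_shift_has_sum[OF q z])
  have Y: "(Y has_sum (- (1 / z) * (qpoch_inf q q * theta q z))) UNIV"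
    unfolding Y_def by (rule theta_term_shift_has_sum[OF q z])
  have A': "s1a.summand q z summable_on {(n, j). 1 \<le> j \<and> 2 * j \<le> n + 1} \<and>
    infsum (s1a.summand q (z * q)) {(n, j). 0 \<le> j \<and> 2 * j \<le> n} = (q * z\<^sup>2) *
      (infsum (s1a.summand q z) {(n, j). 0 \<le> j \<and> 2 * j \<le> n} + infsum (s1a.summand q z) {(n, j). 1 \<le> j \<and> n = 2 * j - 1}
       - infsum (s1a.summand q z) {(n, j). 0 \<le> n \<and> j = 0})"
  \<comment> \<open>Since \<open>hecke (n + 1) (j + 1) = hecke n j + (n - 3 * j) - 1\<close>,
    replacing \<open>z\<close> by \<open>z * q\<close> is the shift by \<open>(1, 1)\<close> up to
    the factor \<open>q * z\<^sup>2\<close>. The second part behaves alike because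
    \<open>hecke (n + 1) (- j - 1) = hecke n (- j) + (n - 3 * j)\<close>.\<close>
  proof (rule infsum_shift[of _ _ _ _ "\<lambda>(n, j). (n - 1, j - 1)" "\<lambda>(n, j). (n + 1, j + 1)" "{(n, j). 1 \<le> j \<and> 2 * j \<le> n + 1}"])
    show "s1a.summand q (z * q) p = (q * z\<^sup>2) * s1a.summand q z ((\<lambda>(n, j). (n + 1, j + 1)) p)" for p
      unfolding s1a.summand_def signed_monomial_mult_q[OF q(2)] case_prod_beta fst_conv snd_conv
    proof (rule trans[OF mult_1_left[symmetric] signed_monomial_eqI[where k = "0" and i = "2" and j = "1"]], goal_cases)
      case 5
      show ?case by (rule double_eqI) (simp add: distrib_left right_diff_distrib two_hecke two_triangular two_pent algebra_simps power2_eq_square)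
    qed (use q z in \<open>auto simp: field_simps power_int_minus power2_eq_square\<close>)
  qed (use q z zq in \<open>auto intro: s1a.summable_on_summand\<close>)
  note A = conjunct2[OF A']
  have B': "s1b.summand q z summable_on {(n, j). 2 \<le> j \<and> 2 * j \<le> n + 1} \<and>
    infsum (s1b.summand q (z * q)) {(n, j). 1 \<le> j \<and> 2 * j \<le> n} = (q * z\<^sup>2) *
      (infsum (s1b.summand q z) {(n, j). 1 \<le> j \<and> 2 * j \<le> n} + infsum (s1b.summand q z) {(n, j). 2 \<le> j \<and> n = 2 * j - 1}
       - infsum (s1b.summand q z) {(n, j). 2 \<le> n \<and> j = 1})"
  proof (rule infsum_shift[of _ _ _ _ "\<lambda>(n, j). (n - 1, j - 1)" "\<lambda>(n, j). (n + 1, j + 1)" "{(n, j). 2 \<le> j \<and> 2 * j \<le> n + 1}"])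
    show "s1b.summand q (z * q) p = (q * z\<^sup>2) * s1b.summand q z ((\<lambda>(n, j). (n + 1, j + 1)) p)" for p
      unfolding s1b.summand_def signed_monomial_mult_q[OF q(2)] case_prod_beta fst_conv snd_conv
    proof (rule trans[OF mult_1_left[symmetric] signed_monomial_eqI[where k = "0" and i = "2" and j = "1"]], goal_cases)
      case 5
      show ?case by (rule double_eqI) (simp add: distrib_left right_diff_distrib two_hecke two_triangular two_pent algebra_simps power2_eq_square)
    qed (use q z in \<open>auto simp: field_simps power_int_minus power2_eq_square\<close>)
  qed (use q z zq in \<open>auto intro: s1b.summable_on_summand\<close>)
  note B = conjunct2[OF B']
  have p1: "(q * z\<^sup>2) * infsum (s1a.summand q z) {(n, j). 1 \<le> j \<and> n = 2 * j - 1} = infsum Y {..0}"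
  proof (rule infsum_mult_reindex[of _ "\<lambda>(n, j). 1 - j" "\<lambda>k. (2 * (1 - k) - 1, 1 - k)"])
    show "Y k = (q * z\<^sup>2) * s1a.summand q z ((\<lambda>k. (2 * (1 - k) - 1, 1 - k)) k)" for k
      unfolding Y_def theta_term_def s1a.summand_def prod.case
    proof (rule signed_monomial_eqI[where k = "1" and i = "3" and j = "1"], goal_cases)
      case 5
      show ?case by (rule double_eqI) (simp add: distrib_left right_diff_distrib two_hecke two_triangular two_pent algebra_simps power2_eq_square)
    qed (use q z in \<open>auto simp: field_simps power_int_minus power2_eq_square power3_eq_cube power4_eq_xxxx\<close>)
  qed auto
  have m1: "(- (q * z\<^sup>2)) * infsum (s1a.summand q z) {(n, j). 0 \<le> n \<and> j = 0} = infsum X {2..}"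
  proof (rule infsum_mult_reindex[of _ "\<lambda>(n, j). n + 2" "\<lambda>k. (k - 2, 0)"])
    show "X k = (- (q * z\<^sup>2)) * s1a.summand q z ((\<lambda>k. (k - 2, 0)) k)" for k
      unfolding X_def theta_term_def s1a.summand_def prod.case
    proof (rule signed_monomial_eqI[where k = "1" and i = "1" and j = "0"], goal_cases)
      case 5
      show ?case by (rule double_eqI) (simp add: distrib_left right_diff_distrib two_hecke two_triangular two_pent algebra_simps power2_eq_square)
    qed (use q z in \<open>auto simp: field_simps power_int_minus power2_eq_square power3_eq_cube power4_eq_xxxx\<close>)
  qed auto
  have p2: "(q * z\<^sup>2) * infsum (s1b.summand q z) {(n, j). 2 \<le> j \<and> n = 2 * j - 1} = infsum X {..0}"
  proof (rule infsum_mult_reindex[of _ "\<lambda>(n, j). 2 - j" "\<lambda>k. (2 * (2 - k) - 1, 2 - k)"])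
    show "X k = (q * z\<^sup>2) * s1b.summand q z ((\<lambda>k. (2 * (2 - k) - 1, 2 - k)) k)" for k
      unfolding X_def theta_term_def s1b.summand_def prod.case
    proof (rule signed_monomial_eqI[where k = "0" and i = "1" and j = "0"], goal_cases)
      case 5
      show ?case by (rule double_eqI) (simp add: distrib_left right_diff_distrib two_hecke two_triangular two_pent algebra_simps power2_eq_square)
    qed (use q z in \<open>auto simp: field_simps power_int_minus power2_eq_square power3_eq_cube power4_eq_xxxx\<close>)
  qed auto
  have m2: "(- (q * z\<^sup>2)) * infsum (s1b.summand q z) {(n, j). 2 \<le> n \<and> j = 1} = infsum Y {2..}"
  proof (rule infsum_mult_reindex[of _ "\<lambda>(n, j). n" "\<lambda>k. (k, 1)"])
    show "Y k = (- (q * z\<^sup>2)) * s1b.summand q z ((\<lambda>k. (k, 1)) k)" for k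
      unfolding Y_def theta_term_def s1b.summand_def prod.case
    proof (rule signed_monomial_eqI[where k = "0" and i = "3" and j = "1"], goal_cases)
      case 5
      show ?case by (rule double_eqI) (simp add: distrib_left right_diff_distrib two_hecke two_triangular two_pent algebra_simps power2_eq_square)
    qed (use q z in \<open>auto simp: field_simps power_int_minus power2_eq_square power3_eq_cube power4_eq_xxxx\<close>)
  qed auto
  have S: "infsum Z UNIV = infsum Z {..0} + Z 1 + infsum Z {2..}" if "Z summable_on UNIV" for Z :: "int \<Rightarrow> complex"
    using infsum_int_split[OF that, of 0] infsum_int_split_insert[OF that, of 1] by simp
  \<comment> \<open>The four rays cover all indices of \<open>X\<close> and \<open>Y\<close> except
    1. The two missing terms are \<open>q * z\<close> and \<open>- q * z\<close>.\<close>
  have "X 1 + Y 1 = 0"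
    using z by (simp add: X_def Y_def theta_term_def signed_monomial_def triangular_def power2_eq_square)
  moreover have "infsum X UNIV + infsum Y UNIV = (q * z - 1 / z) * (qpoch_inf q q * theta q z)"
    using X Y by (simp add: infsumI algebra_simps)
  moreover have "hecke_series1 q (z * q) = q * z\<^sup>2 * hecke_series1 q z +
      (infsum X {..0} + infsum X {2..} + (infsum Y {..0} + infsum Y {2..}))"
    unfolding hecke_series1_def A B p1[symmetric] p2[symmetric] m1[symmetric] m2[symmetric]
    by (simp add: algebra_simps)
  ultimately show ?thesis
    using S[OF has_sum_imp_summable[OF X]] S[OF has_sum_imp_summable[OF Y]]
    by (simp add: algebra_simps add_eq_0_iff2)
qed

lemmas exponent_defs = two_hecke two_triangular two_pent

lemma theta_term_square_arg:
  "theta_term q (z\<^sup>2) k = signed_monomial q z k (2 * k) (triangular k)"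
  by (simp add: theta_term_def signed_monomial_def power_int_mult)

lemma theta_term_square:
  "theta_term (q\<^sup>2) (z\<^sup>2) k = signed_monomial q z k (2 * k) (2 * triangular k)"
  by (simp add: theta_term_def signed_monomial_def power_int_mult)

section \<open>The double series of the second identity\<close>

lemma pent_lower_bound:
  assumes "\<bar>j\<bar> \<le> n"
  shows "n\<^sup>2 + j\<^sup>2 \<le> 16 * (pent n - j\<^sup>2)"
proof -
  have "\<bar>j\<bar>\<^sup>2 \<le> n\<^sup>2"
    using assms by (intro power_mono) auto
  moreover have "2 * pent n = 3 * n\<^sup>2 + n"
    using two_pent[of n] by (simp add: algebra_simps power2_eq_square)
  ultimately show ?thesis
    using assms zero_le_power2[of n] unfolding power2_abs by (smt (verit))
qed

interpretation s2a: lattice_series "{(n, j). \<bar>j\<bar> \<le> n}"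
  "\<lambda>(n, j). j" "\<lambda>(n, j). j" "\<lambda>(n, j). pent n - j\<^sup>2"
  by unfold_locales (auto dest: pent_lower_bound)

interpretation s2b: lattice_series "{(n, j). \<bar>j\<bar> \<le> n}"
  "\<lambda>(n, j). j" "\<lambda>(n, j). j" "\<lambda>(n, j). pent n + (2 * n + 1) - j\<^sup>2"
proof (unfold_locales, goal_cases)
  case (2 n j)
  then show ?case using pent_lower_bound[of j n] by simp
qed auto

definition hecke_series2 :: "complex \<Rightarrow> complex \<Rightarrow> complex" where
  "hecke_series2 q z = infsum (s2a.summand q z) {(n, j). \<bar>j\<bar> \<le> n} - infsum (s2b.summand q z) {(n, j). \<bar>j\<bar> \<le> n}"

text \<open>The new exponent is \<open>- j^2 + 2 j = 1 - (j - 1)^2\<close>, so the shift is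
  \<open>j \<mapsto> j - 1\<close> within each row. The factor \<open>1 - q^(2n+1)\<close> was split
  into two series precisely because their boundary rays give complementary half-lines of
  \<open>X\<close> and \<open>Y\<close>.\<close>

lemma hecke_series2_mult:
  assumes q: "norm q < 1" "q \<noteq> 0" and z: "z \<noteq> 0"
  shows "hecke_series2 q (z * q\<^sup>2) = - q * z * hecke_series2 q z + (1 / (q * z\<^sup>2) - q) * (qpoch_inf q q * theta q z)"
proof -
  have zq: "z * q\<^sup>2 \<noteq> 0" using q z by simp
  define X where "X = (\<lambda>k. - q * theta_term q z (k + 0))"
  define Y where "Y = (\<lambda>k. (1 / (q * z\<^sup>2)) * theta_term q z (k + 2))"
  have X: "(X has_sum (- q * (qpoch_inf q q * theta q z))) UNIV"
    unfolding X_def by (rule theta_term_shift_has_sum) (use q z norm_power2_less_1 in auto)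
  have Y: "(Y has_sum ((1 / (q * z\<^sup>2)) * (qpoch_inf q q * theta q z))) UNIV"
    unfolding Y_def by (rule theta_term_shift_has_sum) (use q z norm_power2_less_1 in auto)
  have A': "s2a.summand q z summable_on {(n, j). \<bar>j + 1\<bar> \<le> n} \<and>
    infsum (s2a.summand q (z * q\<^sup>2)) {(n, j). \<bar>j\<bar> \<le> n} = (- (q * z)) *
      (infsum (s2a.summand q z) {(n, j). \<bar>j\<bar> \<le> n} + infsum (s2a.summand q z) {(n, j). 0 \<le> n \<and> j = - n - 1}
       - infsum (s2a.summand q z) {(n, j). 0 \<le> n \<and> j = n})"
  proof (rule infsum_shift[of _ _ _ _ "\<lambda>(n, j). (n, j + 1)" "\<lambda>(n, j). (n, j - 1)" "{(n, j). \<bar>j + 1\<bar> \<le> n}"])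
    show "s2a.summand q (z * q\<^sup>2) p = (- (q * z)) * s2a.summand q z ((\<lambda>(n, j). (n, j - 1)) p)" for p
      unfolding s2a.summand_def signed_monomial_mult_q2[OF q(2)] case_prod_beta fst_conv snd_conv
    proof (rule trans[OF mult_1_left[symmetric] signed_monomial_eqI[where k = "1" and i = "1" and j = "1"]], goal_cases)
      case 5
      show ?case by (rule double_eqI, unfold distrib_left right_diff_distrib exponent_defs) (simp add: algebra_simps power2_eq_square)
    qed (use q z in \<open>auto simp: field_simps power_int_minus power2_eq_square\<close>)
  qed (rule s2a.summable_on_summand[OF q z], rule s2a.summable_on_summand[OF q zq], use q z in auto)
  note A = conjunct2[OF A']
  have B': "s2b.summand q z summable_on {(n, j). \<bar>j + 1\<bar> \<le> n} \<and>
    infsum (s2b.summand q (z * q\<^sup>2)) {(n, j). \<bar>j\<bar> \<le> n} = (- (q * z)) *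
      (infsum (s2b.summand q z) {(n, j). \<bar>j\<bar> \<le> n} + infsum (s2b.summand q z) {(n, j). 0 \<le> n \<and> j = - n - 1}
       - infsum (s2b.summand q z) {(n, j). 0 \<le> n \<and> j = n})"
  proof (rule infsum_shift[of _ _ _ _ "\<lambda>(n, j). (n, j + 1)" "\<lambda>(n, j). (n, j - 1)" "{(n, j). \<bar>j + 1\<bar> \<le> n}"])
    show "s2b.summand q (z * q\<^sup>2) p = (- (q * z)) * s2b.summand q z ((\<lambda>(n, j). (n, j - 1)) p)" for p
      unfolding s2b.summand_def signed_monomial_mult_q2[OF q(2)] case_prod_beta fst_conv snd_conv
    proof (rule trans[OF mult_1_left[symmetric] signed_monomial_eqI[where k = "1" and i = "1" and j = "1"]], goal_cases)
      case 5
      show ?case by (rule double_eqI, unfold distrib_left right_diff_distrib exponent_defs) (simp add: algebra_simps power2_eq_square)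
    qed (use q z in \<open>auto simp: field_simps power_int_minus power2_eq_square\<close>)
  qed (rule s2b.summable_on_summand[OF q z], rule s2b.summable_on_summand[OF q zq], use q z in auto)
  note B = conjunct2[OF B']
  have pa: "(- (q * z)) * infsum (s2a.summand q z) {(n, j). 0 \<le> n \<and> j = - n - 1} = infsum Y {..0}"
  proof (rule infsum_mult_reindex[of _ "\<lambda>(n, j). - n" "\<lambda>k. (- k, k - 1)"])
    show "Y k = (- (q * z)) * s2a.summand q z ((\<lambda>k. (- k, k - 1)) k)" for k
      unfolding Y_def theta_term_def s2a.summand_def prod.case
    proof (rule signed_monomial_eqI[where k = "1" and i = "3" and j = "2"], goal_cases)
      case 5
      show ?case by (rule double_eqI, unfold distrib_left right_diff_distrib exponent_defs) (simp add: algebra_simps power2_eq_square)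
    qed (use q z in \<open>auto simp: field_simps power_int_minus power2_eq_square power3_eq_cube power4_eq_xxxx\<close>)
  qed auto
  have ma: "(q * z) * infsum (s2a.summand q z) {(n, j). 0 \<le> n \<and> j = n} = infsum X {0 + 1..}"
  proof (rule infsum_mult_reindex[of _ "\<lambda>(n, j). n + 1" "\<lambda>k. (k - 1, k - 1)"])
    show "X k = (q * z) * s2a.summand q z ((\<lambda>k. (k - 1, k - 1)) k)" for k
      unfolding X_def theta_term_def s2a.summand_def prod.case
    proof (rule signed_monomial_eqI[where k = "1" and i = "1" and j = "0"], goal_cases)
      case 5
      show ?case by (rule double_eqI, unfold distrib_left right_diff_distrib exponent_defs) (simp add: algebra_simps power2_eq_square)
    qed (use q z in \<open>auto simp: field_simps power_int_minus power2_eq_square power3_eq_cube power4_eq_xxxx\<close>)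
  qed auto
  have pb: "(q * z) * infsum (s2b.summand q z) {(n, j). 0 \<le> n \<and> j = - n - 1} = infsum X {..0}"
  proof (rule infsum_mult_reindex[of _ "\<lambda>(n, j). - n" "\<lambda>k. (- k, k - 1)"])
    show "X k = (q * z) * s2b.summand q z ((\<lambda>k. (- k, k - 1)) k)" for k
      unfolding X_def theta_term_def s2b.summand_def prod.case
    proof (rule signed_monomial_eqI[where k = "1" and i = "1" and j = "0"], goal_cases)
      case 5
      show ?case by (rule double_eqI, unfold distrib_left right_diff_distrib exponent_defs) (simp add: algebra_simps power2_eq_square)
    qed (use q z in \<open>auto simp: field_simps power_int_minus power2_eq_square power3_eq_cube power4_eq_xxxx\<close>)
  qed auto
  have mb: "(- (q * z)) * infsum (s2b.summand q z) {(n, j). 0 \<le> n \<and> j = n} = infsum Y {0 + 1..}"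
  proof (rule infsum_mult_reindex[of _ "\<lambda>(n, j). n + 1" "\<lambda>k. (k - 1, k - 1)"])
    show "Y k = (- (q * z)) * s2b.summand q z ((\<lambda>k. (k - 1, k - 1)) k)" for k
      unfolding Y_def theta_term_def s2b.summand_def prod.case
    proof (rule signed_monomial_eqI[where k = "1" and i = "3" and j = "2"], goal_cases)
      case 5
      show ?case by (rule double_eqI, unfold distrib_left right_diff_distrib exponent_defs) (simp add: algebra_simps power2_eq_square)
    qed (use q z in \<open>auto simp: field_simps power_int_minus power2_eq_square power3_eq_cube power4_eq_xxxx\<close>)
  qed auto
  have "infsum X UNIV + infsum Y UNIV = (1 / (q * z\<^sup>2) - q) * (qpoch_inf q q * theta q z)"
    using X Y by (simp add: infsumI algebra_simps)
  moreover have "hecke_series2 q (z * q\<^sup>2) = - q * z * hecke_series2 q z +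
      (infsum X {..0} + infsum X {0 + 1..} + (infsum Y {..0} + infsum Y {0 + 1..}))"
    unfolding hecke_series2_def A B pa[symmetric] ma[symmetric] pb[symmetric] mb[symmetric]
    by (simp add: algebra_simps)
  ultimately show ?thesis
    using infsum_int_split[OF has_sum_imp_summable[OF X], of "0"]
      infsum_int_split[OF has_sum_imp_summable[OF Y], of "0"]
    by simp
qed

section \<open>The double series of the third identity\<close>

interpretation s3a: lattice_series "{(n, j). 2 * \<bar>j\<bar> \<le> n}"
  "\<lambda>(n, j). n + j" "\<lambda>(n, j). n + 1" "\<lambda>(n, j). hecke n j"
  by unfold_locales (auto intro: order_trans[OF hecke_lower_bound])

interpretation s3b: lattice_series "{(n, j). 2 * \<bar>j\<bar> \<le> n}"
  "\<lambda>(n, j). n + j" "\<lambda>(n, j). - n" "\<lambda>(n, j). hecke n j"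
  by unfold_locales (auto intro: order_trans[OF hecke_lower_bound])

definition hecke_series3 :: "complex \<Rightarrow> complex \<Rightarrow> complex" where
  "hecke_series3 q z = infsum (s3a.summand q z) {(n, j). 2 * \<bar>j\<bar> \<le> n} + infsum (s3b.summand q z) {(n, j). 2 * \<bar>j\<bar> \<le> n}"

text \<open>From \<open>hecke (n + 1) j = hecke n j + n + 1\<close> and
  \<open>hecke (n - 1) j = hecke n j - n\<close>, the parts with \<open>z powi (n + 1)\<close> and
  \<open>z powi (- n)\<close> move in opposite directions: one only loses boundary points, the other
  only gains them. Each boundary is V-shaped and is cut between \<open>j = -1\<close> and
  \<open>j = 0\<close> into two rays, one for \<open>X\<close> and one for \<open>Y\<close>.\<close>

lemma hecke_series3_mult:
  assumes q: "norm q < 1" "q \<noteq> 0" and z: "z \<noteq> 0"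
  shows "hecke_series3 q (z * q) = - (1 / z) * hecke_series3 q z + (1 / (q * z ^ 4) - 1 / z\<^sup>2) * (qpoch_inf q q * theta q (z\<^sup>2))"
proof -
  have zq: "z * q \<noteq> 0" using q z by simp
  define X where "X = (\<lambda>k. - (1 / z\<^sup>2) * theta_term q (z\<^sup>2) (k + 1))"
  define Y where "Y = (\<lambda>k. (1 / (q * z ^ 4)) * theta_term q (z\<^sup>2) (k + 2))"
  have X: "(X has_sum (- (1 / z\<^sup>2) * (qpoch_inf q q * theta q (z\<^sup>2)))) UNIV"
    unfolding X_def by (rule theta_term_shift_has_sum) (use q z norm_power2_less_1 in auto)
  have Y: "(Y has_sum ((1 / (q * z ^ 4)) * (qpoch_inf q q * theta q (z\<^sup>2)))) UNIV"
    unfolding Y_def by (rule theta_term_shift_has_sum) (use q z norm_power2_less_1 in auto)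
  have A': "s3a.summand q z summable_on {(n, j). 2 * \<bar>j\<bar> \<le> n - 1} \<and>
    infsum (s3a.summand q (z * q)) {(n, j). 2 * \<bar>j\<bar> \<le> n} = (- (1 / z)) *
      (infsum (s3a.summand q z) {(n, j). 2 * \<bar>j\<bar> \<le> n} + infsum (s3a.summand q z) {}
       - infsum (s3a.summand q z) {(n, j). n = 2 * \<bar>j\<bar>})"
  proof (rule infsum_shift[of _ _ _ _ "\<lambda>(n, j). (n - 1, j)" "\<lambda>(n, j). (n + 1, j)" "{(n, j). 2 * \<bar>j\<bar> \<le> n - 1}"])
    show "s3a.summand q (z * q) p = (- (1 / z)) * s3a.summand q z ((\<lambda>(n, j). (n + 1, j)) p)" for p
      unfolding s3a.summand_def signed_monomial_mult_q[OF q(2)] case_prod_beta fst_conv snd_conv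
    proof (rule trans[OF mult_1_left[symmetric] signed_monomial_eqI[where k = "1" and i = "-1" and j = "0"]], goal_cases)
      case 5
      show ?case by (rule double_eqI, unfold distrib_left right_diff_distrib exponent_defs) (simp add: algebra_simps power2_eq_square)
    qed (use q z in \<open>auto simp: field_simps power_int_minus power2_eq_square\<close>)
  qed (rule s3a.summable_on_summand[OF q z], rule s3a.summable_on_summand[OF q zq], use q z in auto)
  note A = conjunct2[OF A']
  have B': "s3b.summand q z summable_on {(n, j). 2 * \<bar>j\<bar> \<le> n + 1} \<and>
    infsum (s3b.summand q (z * q)) {(n, j). 2 * \<bar>j\<bar> \<le> n} = (- (1 / z)) *
      (infsum (s3b.summand q z) {(n, j). 2 * \<bar>j\<bar> \<le> n} + infsum (s3b.summand q z) {(n, j). n = 2 * \<bar>j\<bar> - 1}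
       - infsum (s3b.summand q z) {})"
  proof (rule infsum_shift[of _ _ _ _ "\<lambda>(n, j). (n + 1, j)" "\<lambda>(n, j). (n - 1, j)" "{(n, j). 2 * \<bar>j\<bar> \<le> n + 1}"])
    show "s3b.summand q (z * q) p = (- (1 / z)) * s3b.summand q z ((\<lambda>(n, j). (n - 1, j)) p)" for p
      unfolding s3b.summand_def signed_monomial_mult_q[OF q(2)] case_prod_beta fst_conv snd_conv
    proof (rule trans[OF mult_1_left[symmetric] signed_monomial_eqI[where k = "1" and i = "-1" and j = "0"]], goal_cases)
      case 5
      show ?case by (rule double_eqI, unfold distrib_left right_diff_distrib exponent_defs) (simp add: algebra_simps power2_eq_square)
    qed (use q z in \<open>auto simp: field_simps power_int_minus power2_eq_square\<close>)
  qed (rule s3b.summable_on_summand[OF q z], rule s3b.summable_on_summand[OF q zq], use q z in auto)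
  note B = conjunct2[OF B']
  have ma1: "(1 / z) * infsum (s3a.summand q z) {(n, j). 0 \<le> j \<and> n = 2 * j} = infsum X {- 1 + 1..}"
  proof (rule infsum_mult_reindex[of _ "\<lambda>(n, j). j" "\<lambda>k. (2 * k, k)"])
    show "X k = (1 / z) * s3a.summand q z ((\<lambda>k. (2 * k, k)) k)" for k
      unfolding X_def theta_term_square_arg s3a.summand_def prod.case
    proof (rule signed_monomial_eqI[where k = "1" and i = "1" and j = "0"], goal_cases)
      case 5
      show ?case by (rule double_eqI, unfold distrib_left right_diff_distrib exponent_defs) (simp add: algebra_simps power2_eq_square)
    qed (use q z in \<open>auto simp: field_simps power_int_minus power2_eq_square power3_eq_cube power4_eq_xxxx\<close>)
  qed auto
  have ma2: "(1 / z) * infsum (s3a.summand q z) {(n, j). j \<le> -1 \<and> n = - 2 * j} = infsum Y {0 + 1..}"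
  proof (rule infsum_mult_reindex[of _ "\<lambda>(n, j). - j" "\<lambda>k. (2 * k, - k)"])
    show "Y k = (1 / z) * s3a.summand q z ((\<lambda>k. (2 * k, - k)) k)" for k
      unfolding Y_def theta_term_square_arg s3a.summand_def prod.case
    proof (rule signed_monomial_eqI[where k = "0" and i = "3" and j = "1"], goal_cases)
      case 5
      show ?case by (rule double_eqI, unfold distrib_left right_diff_distrib exponent_defs) (simp add: algebra_simps power2_eq_square)
    qed (use q z in \<open>auto simp: field_simps power_int_minus power2_eq_square power3_eq_cube power4_eq_xxxx\<close>)
  qed auto
  have pb1: "(- (1 / z)) * infsum (s3b.summand q z) {(n, j). 0 \<le> j \<and> n = 2 * j - 1} = infsum Y {..0}"
  proof (rule infsum_mult_reindex[of _ "\<lambda>(n, j). - j" "\<lambda>k. (- 2 * k - 1, - k)"])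
    show "Y k = (- (1 / z)) * s3b.summand q z ((\<lambda>k. (- 2 * k - 1, - k)) k)" for k
      unfolding Y_def theta_term_square_arg s3b.summand_def prod.case
    proof (rule signed_monomial_eqI[where k = "1" and i = "3" and j = "1"], goal_cases)
      case 5
      show ?case by (rule double_eqI, unfold distrib_left right_diff_distrib exponent_defs) (simp add: algebra_simps power2_eq_square)
    qed (use q z in \<open>auto simp: field_simps power_int_minus power2_eq_square power3_eq_cube power4_eq_xxxx\<close>)
  qed auto
  have pb2: "(- (1 / z)) * infsum (s3b.summand q z) {(n, j). j \<le> -1 \<and> n = - 2 * j - 1} = infsum X {..- 1}"
  proof (rule infsum_mult_reindex[of _ "\<lambda>(n, j). j" "\<lambda>k. (- 2 * k - 1, k)"])
    show "X k = (- (1 / z)) * s3b.summand q z ((\<lambda>k. (- 2 * k - 1, k)) k)" for k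
      unfolding X_def theta_term_square_arg s3b.summand_def prod.case
    proof (rule signed_monomial_eqI[where k = "0" and i = "1" and j = "0"], goal_cases)
      case 5
      show ?case by (rule double_eqI, unfold distrib_left right_diff_distrib exponent_defs) (simp add: algebra_simps power2_eq_square)
    qed (use q z in \<open>auto simp: field_simps power_int_minus power2_eq_square power3_eq_cube power4_eq_xxxx\<close>)
  qed auto
  have sM: "infsum (s3a.summand q z) {(n, j). n = 2 * \<bar>j\<bar>} = infsum (s3a.summand q z) {(n, j). 0 \<le> j \<and> n = 2 * j} + infsum (s3a.summand q z) {(n, j). j \<le> -1 \<and> n = - 2 * j}"
    by (subst infsum_Un_disjoint[symmetric])
       (auto intro!: summable_on_subset[OF s3a.summable_on_summand[OF q z]] arg_cong[of _ _ "infsum _"])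
  have sP: "infsum (s3b.summand q z) {(n, j). n = 2 * \<bar>j\<bar> - 1} = infsum (s3b.summand q z) {(n, j). 0 \<le> j \<and> n = 2 * j - 1} + infsum (s3b.summand q z) {(n, j). j \<le> -1 \<and> n = - 2 * j - 1}"
    by (subst infsum_Un_disjoint[symmetric])
       (auto intro!: summable_on_subset[OF conjunct1[OF B']] arg_cong[of _ _ "infsum _"])
  have "infsum X UNIV + infsum Y UNIV = (1 / (q * z ^ 4) - 1 / z\<^sup>2) * (qpoch_inf q q * theta q (z\<^sup>2))"
    using X Y by (simp add: infsumI algebra_simps)
  moreover have "hecke_series3 q (z * q) = - (1 / z) * hecke_series3 q z +
      (infsum X {..- 1} + infsum X {- 1 + 1..} + (infsum Y {..0} + infsum Y {0 + 1..}))"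
    unfolding hecke_series3_def A B sM sP ma1[symmetric] ma2[symmetric] pb1[symmetric] pb2[symmetric]
    by (simp add: algebra_simps)
  ultimately show ?thesis
    using infsum_int_split[OF has_sum_imp_summable[OF X], of "- 1"]
      infsum_int_split[OF has_sum_imp_summable[OF Y], of "0"]
    by simp
qed

section \<open>The double series of the fourth identity\<close>

interpretation s4a: lattice_series "{(n, j). 0 \<le> n \<and> - 2 * n - 1 \<le> j \<and> j \<le> 2 * n}"
  "\<lambda>(n, j). n" "\<lambda>(n, j). j + 1" "\<lambda>(n, j). 3 * n\<^sup>2 + 2 * n - triangular (j + 1)"
proof (unfold_locales, goal_cases)
  case (2 n j)
  \<comment> \<open>The product of the distances of \<open>j\<close> from the two ends of its row
    bounds \<open>j * j + j\<close>, hence the subtracted triangular number.\<close>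
  then have "0 \<le> n" "- 2 * n - 1 \<le> j" "0 \<le> (2 * n - j) * (2 * n + 1 + j)"
    by (auto intro!: mult_nonneg_nonneg)
  then have "j * j + j \<le> 4 * (n * n) + 2 * n"
    by (simp add: algebra_simps)
  moreover have "2 * triangular (j + 1) = j * j + j"
    by (simp add: two_triangular algebra_simps)
  moreover have "0 \<le> n * n" by simp
  ultimately show ?case
    using \<open>_ \<le> n\<close> \<open>_ \<le> j\<close> unfolding prod.case power2_eq_square by (smt (verit))
qed auto

interpretation s4b: lattice_series "{(n, j). 1 \<le> n \<and> - 2 * n + 1 \<le> j \<and> j \<le> 2 * n - 2}"
  "\<lambda>(n, j). n" "\<lambda>(n, j). j + 1" "\<lambda>(n, j). 3 * n\<^sup>2 - 2 * n - triangular (j + 1)"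
proof (unfold_locales, goal_cases)
  case (2 n j)
  then have "1 \<le> n" "- 2 * n + 1 \<le> j" "0 \<le> (2 * n - 2 - j) * (2 * n - 1 + j)"
    by (auto intro!: mult_nonneg_nonneg)
  then have "j * j + j \<le> 4 * (n * n) - 6 * n + 2"
    by (simp add: algebra_simps)
  moreover have "2 * triangular (j + 1) = j * j + j"
    by (simp add: two_triangular algebra_simps)
  moreover have "0 \<le> n * n" by simp
  ultimately show ?case
    using \<open>_ \<le> n\<close> \<open>_ \<le> j\<close> unfolding prod.case power2_eq_square by (smt (verit))
qed auto

text \<open>
  The terms with \<open>z powi (- j)\<close> are those with \<open>z powi (j + 1)\<close> for the negative index \<open>- j - 1\<close>.
\<close>

definition hecke_series4 :: "complex \<Rightarrow> complex \<Rightarrow> complex" where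
  "hecke_series4 q z = infsum (s4a.summand q z) {(n, j). 0 \<le> n \<and> - 2 * n - 1 \<le> j \<and> j \<le> 2 * n}
    - infsum (s4b.summand q z) {(n, j). 1 \<le> n \<and> - 2 * n + 1 \<le> j \<and> j \<le> 2 * n - 2}"

text \<open>Adding \<open>j + 1\<close> to the exponent gives \<open>1 - triangular j\<close>, so
  each row shifts by \<open>j \<mapsto> j - 1\<close> at the cost of \<open>q * z\<close>. The end
  points of the rows \<open>n\<close> contribute complementary half-lines from the two
  series.\<close>

lemma hecke_series4_mult:
  assumes q: "norm q < 1" "q \<noteq> 0" and z: "z \<noteq> 0"
  shows "hecke_series4 q (z * q) = q * z * hecke_series4 q z + (q - 1 / z\<^sup>2) * (qpoch_inf (q\<^sup>2) (q\<^sup>2) * theta (q\<^sup>2) (z\<^sup>2))"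
proof -
  have zq: "z * q \<noteq> 0" using q z by simp
  define X where "X = (\<lambda>k. q * theta_term (q\<^sup>2) (z\<^sup>2) (k + 0))"
  define Y where "Y = (\<lambda>k. - (1 / z\<^sup>2) * theta_term (q\<^sup>2) (z\<^sup>2) (k + 1))"
  have X: "(X has_sum (q * (qpoch_inf (q\<^sup>2) (q\<^sup>2) * theta (q\<^sup>2) (z\<^sup>2)))) UNIV"
    unfolding X_def by (rule theta_term_shift_has_sum) (use q z norm_power2_less_1 in auto)
  have Y: "(Y has_sum (- (1 / z\<^sup>2) * (qpoch_inf (q\<^sup>2) (q\<^sup>2) * theta (q\<^sup>2) (z\<^sup>2)))) UNIV"
    unfolding Y_def by (rule theta_term_shift_has_sum) (use q z norm_power2_less_1 in auto)
  have A': "s4a.summand q z summable_on {(n, j). 0 \<le> n \<and> - 2 * n - 2 \<le> j \<and> j \<le> 2 * n - 1} \<and>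
    infsum (s4a.summand q (z * q)) {(n, j). 0 \<le> n \<and> - 2 * n - 1 \<le> j \<and> j \<le> 2 * n} = (q * z) *
      (infsum (s4a.summand q z) {(n, j). 0 \<le> n \<and> - 2 * n - 1 \<le> j \<and> j \<le> 2 * n} + infsum (s4a.summand q z) {(n, j). 0 \<le> n \<and> j = - 2 * n - 2}
       - infsum (s4a.summand q z) {(n, j). 0 \<le> n \<and> j = 2 * n})"
  proof (rule infsum_shift[of _ _ _ _ "\<lambda>(n, j). (n, j + 1)" "\<lambda>(n, j). (n, j - 1)" "{(n, j). 0 \<le> n \<and> - 2 * n - 2 \<le> j \<and> j \<le> 2 * n - 1}"])
    show "s4a.summand q (z * q) p = (q * z) * s4a.summand q z ((\<lambda>(n, j). (n, j - 1)) p)" for p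
      unfolding s4a.summand_def signed_monomial_mult_q[OF q(2)] case_prod_beta fst_conv snd_conv
    proof (rule trans[OF mult_1_left[symmetric] signed_monomial_eqI[where k = "0" and i = "1" and j = "1"]], goal_cases)
      case 5
      show ?case by (rule double_eqI, unfold distrib_left right_diff_distrib exponent_defs) (simp add: algebra_simps power2_eq_square)
    qed (use q z in \<open>auto simp: field_simps power_int_minus power2_eq_square\<close>)
  qed (rule s4a.summable_on_summand[OF q z], rule s4a.summable_on_summand[OF q zq], use q z in auto)
  note A = conjunct2[OF A']
  have B': "s4b.summand q z summable_on {(n, j). 1 \<le> n \<and> - 2 * n \<le> j \<and> j \<le> 2 * n - 3} \<and>
    infsum (s4b.summand q (z * q)) {(n, j). 1 \<le> n \<and> - 2 * n + 1 \<le> j \<and> j \<le> 2 * n - 2} = (q * z) *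
      (infsum (s4b.summand q z) {(n, j). 1 \<le> n \<and> - 2 * n + 1 \<le> j \<and> j \<le> 2 * n - 2} + infsum (s4b.summand q z) {(n, j). 1 \<le> n \<and> j = - 2 * n}
       - infsum (s4b.summand q z) {(n, j). 1 \<le> n \<and> j = 2 * n - 2})"
  proof (rule infsum_shift[of _ _ _ _ "\<lambda>(n, j). (n, j + 1)" "\<lambda>(n, j). (n, j - 1)" "{(n, j). 1 \<le> n \<and> - 2 * n \<le> j \<and> j \<le> 2 * n - 3}"])
    show "s4b.summand q (z * q) p = (q * z) * s4b.summand q z ((\<lambda>(n, j). (n, j - 1)) p)" for p
      unfolding s4b.summand_def signed_monomial_mult_q[OF q(2)] case_prod_beta fst_conv snd_conv
    proof (rule trans[OF mult_1_left[symmetric] signed_monomial_eqI[where k = "0" and i = "1" and j = "1"]], goal_cases)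
      case 5
      show ?case by (rule double_eqI, unfold distrib_left right_diff_distrib exponent_defs) (simp add: algebra_simps power2_eq_square)
    qed (use q z in \<open>auto simp: field_simps power_int_minus power2_eq_square\<close>)
  qed (rule s4b.summable_on_summand[OF q z], rule s4b.summable_on_summand[OF q zq], use q z in auto)
  note B = conjunct2[OF B']
  have pa: "(q * z) * infsum (s4a.summand q z) {(n, j). 0 \<le> n \<and> j = - 2 * n - 2} = infsum Y {..0}"
  proof (rule infsum_mult_reindex[of _ "\<lambda>(n, j). - n" "\<lambda>k. (- k, 2 * k - 2)"])
    show "Y k = (q * z) * s4a.summand q z ((\<lambda>k. (- k, 2 * k - 2)) k)" for k
      unfolding Y_def theta_term_square s4a.summand_def prod.case
    proof (rule signed_monomial_eqI[where k = "1" and i = "3" and j = "1"], goal_cases)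
      case 5
      show ?case by (rule double_eqI, unfold distrib_left right_diff_distrib exponent_defs) (simp add: algebra_simps power2_eq_square)
    qed (use q z in \<open>auto simp: field_simps power_int_minus power2_eq_square power3_eq_cube power4_eq_xxxx\<close>)
  qed auto
  have ma: "(- (q * z)) * infsum (s4a.summand q z) {(n, j). 0 \<le> n \<and> j = 2 * n} = infsum X {0 + 1..}"
  proof (rule infsum_mult_reindex[of _ "\<lambda>(n, j). n + 1" "\<lambda>k. (k - 1, 2 * k - 2)"])
    show "X k = (- (q * z)) * s4a.summand q z ((\<lambda>k. (k - 1, 2 * k - 2)) k)" for k
      unfolding X_def theta_term_square s4a.summand_def prod.case
    proof (rule signed_monomial_eqI[where k = "1" and i = "1" and j = "0"], goal_cases)
      case 5
      show ?case by (rule double_eqI, unfold distrib_left right_diff_distrib exponent_defs) (simp add: algebra_simps power2_eq_square)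
    qed (use q z in \<open>auto simp: field_simps power_int_minus power2_eq_square power3_eq_cube power4_eq_xxxx\<close>)
  qed auto
  have pb: "(- (q * z)) * infsum (s4b.summand q z) {(n, j). 1 \<le> n \<and> j = - 2 * n} = infsum X {..0}"
  proof (rule infsum_mult_reindex[of _ "\<lambda>(n, j). 1 - n" "\<lambda>k. (1 - k, 2 * k - 2)"])
    show "X k = (- (q * z)) * s4b.summand q z ((\<lambda>k. (1 - k, 2 * k - 2)) k)" for k
      unfolding X_def theta_term_square s4b.summand_def prod.case
    proof (rule signed_monomial_eqI[where k = "1" and i = "1" and j = "0"], goal_cases)
      case 5
      show ?case by (rule double_eqI, unfold distrib_left right_diff_distrib exponent_defs) (simp add: algebra_simps power2_eq_square)
    qed (use q z in \<open>auto simp: field_simps power_int_minus power2_eq_square power3_eq_cube power4_eq_xxxx\<close>)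
  qed auto
  have mb: "(q * z) * infsum (s4b.summand q z) {(n, j). 1 \<le> n \<and> j = 2 * n - 2} = infsum Y {0 + 1..}"
  proof (rule infsum_mult_reindex[of _ "\<lambda>(n, j). n" "\<lambda>k. (k, 2 * k - 2)"])
    show "Y k = (q * z) * s4b.summand q z ((\<lambda>k. (k, 2 * k - 2)) k)" for k
      unfolding Y_def theta_term_square s4b.summand_def prod.case
    proof (rule signed_monomial_eqI[where k = "1" and i = "3" and j = "1"], goal_cases)
      case 5
      show ?case by (rule double_eqI, unfold distrib_left right_diff_distrib exponent_defs) (simp add: algebra_simps power2_eq_square)
    qed (use q z in \<open>auto simp: field_simps power_int_minus power2_eq_square power3_eq_cube power4_eq_xxxx\<close>)
  qed auto
  have "infsum X UNIV + infsum Y UNIV = (q - 1 / z\<^sup>2) * (qpoch_inf (q\<^sup>2) (q\<^sup>2) * theta (q\<^sup>2) (z\<^sup>2))"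
    using X Y by (simp add: infsumI algebra_simps)
  moreover have "hecke_series4 q (z * q) = q * z * hecke_series4 q z +
      (infsum X {..0} + infsum X {0 + 1..} + (infsum Y {..0} + infsum Y {0 + 1..}))"
    unfolding hecke_series4_def A B pa[symmetric] ma[symmetric] pb[symmetric] mb[symmetric]
    by (simp add: algebra_simps)
  ultimately show ?thesis
    using infsum_int_split[OF has_sum_imp_summable[OF X], of "0"]
      infsum_int_split[OF has_sum_imp_summable[OF Y], of "0"]
    by simp
qed

section \<open>The four identities\<close>

lemma cleared_rank_eq_hecke_series1:
  assumes q: "norm q < 1" "q \<noteq> 0" and z: "z \<noteq> 0"
  shows "cleared_rank q z = hecke_series1 q z"
proof -
  have "cleared_rank q z - hecke_series1 q z = 0"
  proof (rule quasi_periodic_eq_0[where q = q and c = q and w = 2 and z = z])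
    show "(\<lambda>z. cleared_rank q z - hecke_series1 q z) holomorphic_on - {0}"
      unfolding hecke_series1_def
      by (intro holomorphic_intros holomorphic_cleared_rank s1a.holomorphic_lattice_series
          s1b.holomorphic_lattice_series q)
    show "cleared_rank q (z * q) - hecke_series1 q (z * q) = q * z\<^sup>2 * (cleared_rank q z - hecke_series1 q z)"
      if "z \<noteq> 0" for z
      unfolding cleared_rank_mult_q[OF q that] hecke_series1_mult_q[OF q that] by (simp add: algebra_simps)
  qed (use q z in auto)
  then show ?thesis by simp
qed

lemma rank_theta_product2_eq_hecke_series2:
  assumes q: "norm q < 1" "q \<noteq> 0" and z: "z \<noteq> 0"
  shows "rank_theta_product2 q z = hecke_series2 q z"
proof -
  have "rank_theta_product2 q z - hecke_series2 q z = 0"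
  proof (rule quasi_periodic_eq_0[where q = "q\<^sup>2" and c = "- q" and w = 1 and z = z])
    show "(\<lambda>z. rank_theta_product2 q z - hecke_series2 q z) holomorphic_on - {0}"
      unfolding hecke_series2_def
      by (intro holomorphic_intros holomorphic_rank_theta_product2 s2a.holomorphic_lattice_series
          s2b.holomorphic_lattice_series q)
    show "rank_theta_product2 q (z * q\<^sup>2) - hecke_series2 q (z * q\<^sup>2) = - q * z ^ 1 * (rank_theta_product2 q z - hecke_series2 q z)"
      if "z \<noteq> 0" for z
      unfolding rank_theta_product2_mult[OF q that] hecke_series2_mult[OF q that] by (simp add: algebra_simps)
  qed (use q z norm_power2_less_1 in auto)
  then show ?thesis by simp
qed

text \<open>Inversion exchanges the two parts, since \<open>z powi (- n - 1)\<close> is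
  \<open>z powi (- n)\<close> divided by \<open>z\<close>.\<close>

lemma hecke_series3_inverse:
  assumes z: "z \<noteq> 0"
  shows "hecke_series3 q (1 / z) = hecke_series3 q z / z"
proof -
  have "s3a.summand q (1 / z) = (\<lambda>p. 1 / z * s3b.summand q z p)"
       "s3b.summand q (1 / z) = (\<lambda>p. 1 / z * s3a.summand q z p)"
    using z by (auto simp: s3a.summand_def s3b.summand_def signed_monomial_def power_int_minus
        power_int_divide_distrib power_int_add field_simps)
  then show ?thesis
    by (simp only: hecke_series3_def infsum_cmult_right') (simp add: add_divide_distrib)
qed

lemma rank_theta_product3_eq_hecke_series3:
  assumes q: "norm q < 1" "q \<noteq> 0" and z: "z \<noteq> 0"
  shows "rank_theta_product3 q z = hecke_series3 q z"
proof -
  have "rank_theta_product3 q z - hecke_series3 q z = 0"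
  proof (rule quasi_periodic_symmetric_eq_0[where q = q and z = z])
    show "(\<lambda>z. rank_theta_product3 q z - hecke_series3 q z) holomorphic_on - {0}"
      unfolding hecke_series3_def
      by (intro holomorphic_intros holomorphic_rank_theta_product3 s3a.holomorphic_lattice_series
          s3b.holomorphic_lattice_series q)
    show "rank_theta_product3 q (z * q) - hecke_series3 q (z * q) = - (rank_theta_product3 q z - hecke_series3 q z) / z" if "z \<noteq> 0" for z
      using that by (simp add: rank_theta_product3_mult[OF q] hecke_series3_mult[OF q] diff_divide_distrib)
    show "rank_theta_product3 q (1 / z) - hecke_series3 q (1 / z) = (rank_theta_product3 q z - hecke_series3 q z) / z" if "z \<noteq> 0" for z
      using that by (simp add: rank_theta_product3_inverse[OF q] hecke_series3_inverse diff_divide_distrib)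
  qed (use q z in auto)
  then show ?thesis by simp
qed

lemma rank_theta_product4_eq_hecke_series4:
  assumes q: "norm q < 1" "q \<noteq> 0" and z: "z \<noteq> 0"
  shows "rank_theta_product4 q z = hecke_series4 q z"
proof -
  have "rank_theta_product4 q z - hecke_series4 q z = 0"
  proof (rule quasi_periodic_eq_0[where q = q and c = q and w = 1 and z = z])
    show "(\<lambda>z. rank_theta_product4 q z - hecke_series4 q z) holomorphic_on - {0}"
      unfolding hecke_series4_def
      by (intro holomorphic_intros holomorphic_rank_theta_product4 s4a.holomorphic_lattice_series
          s4b.holomorphic_lattice_series q)
    show "rank_theta_product4 q (z * q) - hecke_series4 q (z * q) = q * z ^ 1 * (rank_theta_product4 q z - hecke_series4 q z)"
      if "z \<noteq> 0" for z
      unfolding rank_theta_product4_mult[OF q that] hecke_series4_mult[OF q that] by (simp add: algebra_simps)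
  qed (use q z in auto)
  then show ?thesis by simp
qed

text \<open>Passes from the unordered sum over the lattice to the iterated sums of the theorem:
  \<open>J n\<close> is the finite row at height \<open>n + c\<close>, and \<open>c\<close> is the
  first height that occurs.\<close>

lemma sums_lattice_rows:
  fixes f :: "int \<times> int \<Rightarrow> complex"
  assumes f: "f summable_on D" and J: "\<And>n. finite (J n)"
    and D: "\<And>a j. (a, j) \<in> D \<longleftrightarrow> c \<le> a \<and> j \<in> J (nat (a - c))"
  shows "(\<lambda>n. \<Sum>j\<in>J n. f (int n + c, j)) sums infsum f D"
proof -
  have "((\<lambda>(n, j). f (int n + c, j)) has_sum infsum f D) (Sigma UNIV J)"
    using has_sum_infsum[OF f]
    by (subst has_sum_reindex_bij_witness[of _ "\<lambda>(a, j). (nat (a - c), j)" "\<lambda>(n, j). (int n + c, j)" D f])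
       (auto simp: D)
  then have "((\<lambda>n. \<Sum>j\<in>J n. f (int n + c, j)) has_sum infsum f D) UNIV"
    by (rule has_sum_SigmaD) (use J in \<open>auto intro: has_sum_finite\<close>)
  then show ?thesis by (rule has_sum_imp_sums)
qed

text \<open>Folds a row along the reflection \<open>j \<mapsto> - j - 1\<close>, which pairs
  \<open>z powi (j + 1)\<close> with \<open>z powi (- j)\<close> in the fourth identity.\<close>

lemma sum_symmetric_int:
  fixes g :: "int \<Rightarrow> complex"
  assumes "0 \<le> N"
  shows "(\<Sum>j\<in>{- N - 1..N}. g j) = (\<Sum>j\<in>{0..N}. g j + g (- j - 1))"
proof -
  have "{- N - 1..N} = {0..N} \<union> {- N - 1..- 1}" using assms by auto
  then have "(\<Sum>j\<in>{- N - 1..N}. g j) = (\<Sum>j\<in>{0..N}. g j) + (\<Sum>j\<in>{- N - 1..- 1}. g j)"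
    by (simp add: sum.union_disjoint)
  also have "(\<Sum>j\<in>{- N - 1..- 1}. g j) = (\<Sum>j\<in>{0..N}. g (- j - 1))"
    by (rule sum.reindex_bij_witness[of _ "\<lambda>j. - j - 1" "\<lambda>j. - j - 1"]) auto
  finally show ?thesis by (simp add: sum.distrib)
qed

lemma rank_gf_0 [simp]: "rank_gf z 0 = 1"
proof -
  have "rank_gf z 0 = (\<Sum>n\<in>{0}. 0 ^ n\<^sup>2 / (qpoch (z * 0) 0 n * qpoch (0 / z) 0 n))"
    unfolding rank_gf_def by (rule suminf_finite) auto
  then show ?thesis by simp
qed

lemma sums_first:
  fixes f :: "nat \<Rightarrow> complex"
  assumes "\<And>n. n > 0 \<Longrightarrow> f n = 0"
  shows "f sums f 0"
  using sums_finite[of "{0}" f] assms by auto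

text \<open>For \<open>q = 0\<close>: a positive exponent makes the term vanish, so every row with
  \<open>n > 0\<close> drops out.\<close>

lemma hecke_pos: "0 < n \<Longrightarrow> 2 * \<bar>j\<bar> \<le> n \<Longrightarrow> 0 < hecke n j"
  using hecke_lower_bound[of j n] zero_less_power[of n 2] zero_le_power2[of j] by linarith

lemma hecke_rogers_1:
  assumes q: "norm q < 1" and z: "z \<noteq> 0"
    and nz: "\<forall>k\<ge>1. z * q ^ k \<noteq> 1 \<and> q ^ k \<noteq> z"
  shows "(\<lambda>n::nat. (1/2) *
         ((\<Sum>j\<in>{0..int n div 2}. (-1) powi (int n + j) *
             (z powi (int n - 3*j) + z powi (3*j - int n)) *
             q powi ((int n ^ 2 - 3 * j ^ 2 + int n - j) div 2))
        + (\<Sum>j\<in>{1..int n div 2}. (-1) powi (int n + j) *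
             (z powi (int n - 3*j + 1) + z powi (3*j - int n - 1)) *
             q powi ((int n ^ 2 - 3 * j ^ 2 + int n + j) div 2))))
      sums (qpoch_inf (z * q) q * qpoch_inf (q / z) q * qpoch_inf q q * rank_gf z q)"
    (is "?f sums ?L")
proof (cases "q = 0")
  case True
  have "?f n = 0" if "n > 0" for n
  proof -
    have "hecke (int n) j \<noteq> 0" "hecke (int n) (- j) \<noteq> 0" if "0 \<le> j" "j \<le> int n div 2" for j
      using hecke_pos[of "int n" j] hecke_pos[of "int n" "- j"] that \<open>n > 0\<close> by force+
    then have "(int n ^ 2 - 3 * j ^ 2 + int n - j) div 2 \<noteq> 0"
      "(int n ^ 2 - 3 * j ^ 2 + int n + j) div 2 \<noteq> 0" if "0 \<le> j" "j \<le> int n div 2" for j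
      using that by (simp_all add: hecke_def)
    then show ?thesis by (simp add: True)
  qed
  then have "?f sums ?f 0" by (rule sums_first)
  then show ?thesis by (simp add: True)
next
  case False
  have half: "(\<lambda>n. (\<Sum>j\<in>{0..int n div 2}. s1a.summand q x (int n + 0, j))
      + (\<Sum>j\<in>{1..int n div 2}. s1b.summand q x (int n + 0, j))) sums hecke_series1 q x" if "x \<noteq> 0" for x
    unfolding hecke_series1_def
    by (intro sums_add sums_lattice_rows s1a.summable_on_summand s1b.summable_on_summand q False that) auto
  \<comment> \<open>The invariance is not visible in the series; it is inherited from the rank
    function. It allows averaging over \<open>z\<close> and \<open>1 / z\<close>, which produces the
    symmetric summands and the factor \<open>1/2\<close>.\<close>
  have "hecke_series1 q (1 / z) = hecke_series1 q z"
    using cleared_rank_eq_hecke_series1[OF q False] z by (metis cleared_rank_inverse divide_eq_0_iff one_neq_zero)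
  then have "1 / 2 * (hecke_series1 q z + hecke_series1 q (1 / z)) = hecke_series1 q z"
    by simp
  moreover have "(\<lambda>n. 1 / 2 *
      ((\<Sum>j\<in>{0..int n div 2}. s1a.summand q z (int n + 0, j) + s1a.summand q (1 / z) (int n + 0, j))
      + (\<Sum>j\<in>{1..int n div 2}. s1b.summand q z (int n + 0, j) + s1b.summand q (1 / z) (int n + 0, j))))
    sums (1 / 2 * (hecke_series1 q z + hecke_series1 q (1 / z)))"
    using sums_mult[OF sums_add[OF half[of z] half[of "1 / z"]], of "1 / 2"] z
    by (simp only: sum.distrib add_ac) auto
  moreover have "s1a.summand q z (int n + 0, j) + s1a.summand q (1 / z) (int n + 0, j) =
      (-1) powi (int n + j) * (z powi (int n - 3*j) + z powi (3*j - int n)) *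
      q powi ((int n ^ 2 - 3 * j ^ 2 + int n - j) div 2)" for n j
    unfolding s1a.summand_def signed_monomial_inverse by (simp add: signed_monomial_def hecke_def algebra_simps)
  moreover have "s1b.summand q z (int n + 0, j) + s1b.summand q (1 / z) (int n + 0, j) =
      (-1) powi (int n + j) * (z powi (int n - 3*j + 1) + z powi (3*j - int n - 1)) *
      q powi ((int n ^ 2 - 3 * j ^ 2 + int n + j) div 2)" for n j
    unfolding s1b.summand_def signed_monomial_inverse by (simp add: signed_monomial_def hecke_def algebra_simps)
  ultimately have "?f sums hecke_series1 q z"
    by (simp only:)
  then show ?thesis
    using cleared_rank_eq[OF q z nz] cleared_rank_eq_hecke_series1[OF q False z] by simp
qed

lemma hecke_rogers_2:
  assumes q: "norm q < 1" and z: "z \<noteq> 0"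
    and nz: "\<forall>k\<ge>1. z * q ^ (2*k) \<noteq> 1 \<and> q ^ (2*k) \<noteq> z"
  shows "(\<lambda>n::nat. \<Sum>j\<in>{- int n..int n}. (-1) powi j * z powi j *
             q powi (int n * (3 * int n + 1) div 2 - j ^ 2) * (1 - q ^ (2*n+1)))
      sums (qpoch_inf (z * q) q * qpoch_inf (q / z) q * qpoch_inf q q * rank_gf z (q ^ 2))"
    (is "?f sums ?L")
proof (cases "q = 0")
  case True
  have "?f n = 0" if "n > 0" for n
  proof -
    have "0 < (int n)\<^sup>2" using \<open>n > 0\<close> by simp
    then have "pent (int n) - j\<^sup>2 \<noteq> 0" if "- int n \<le> j" "j \<le> int n" for j
      using pent_lower_bound[of j "int n"] that zero_le_power2[of j] by (smt (verit))
    then have "int n * (3 * int n + 1) div 2 - j ^ 2 \<noteq> 0" if "- int n \<le> j" "j \<le> int n" for j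
      using that by (simp add: pent_def)
    then show ?thesis by (simp add: True)
  qed
  then have "?f sums ?f 0" by (rule sums_first)
  then show ?thesis by (simp add: True)
next
  case False
  have "(\<lambda>n. (\<Sum>j\<in>{- int n..int n}. s2a.summand q z (int n + 0, j))
      - (\<Sum>j\<in>{- int n..int n}. s2b.summand q z (int n + 0, j))) sums hecke_series2 q z"
    unfolding hecke_series2_def
    by (intro sums_diff sums_lattice_rows s2a.summable_on_summand s2b.summable_on_summand q False z) auto
  moreover have "(\<Sum>j\<in>{- int n..int n}. s2a.summand q z (int n + 0, j))
      - (\<Sum>j\<in>{- int n..int n}. s2b.summand q z (int n + 0, j)) = ?f n" for n
    unfolding sum_subtractf[symmetric]
  proof (rule sum.cong[OF refl])
    fix j
    \<comment> \<open>Reassembles the factor \<open>1 - q ^ (2 * n + 1)\<close> from the two series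
      into which it was split.\<close>
    have "q powi (pent (int n) + (2 * int n + 1) - j\<^sup>2) = q powi (pent (int n) - j\<^sup>2) * q powi int (2 * n + 1)"
      using False by (simp flip: power_int_add) (simp add: algebra_simps)
    then show "s2a.summand q z (int n + 0, j) - s2b.summand q z (int n + 0, j) = (-1) powi j * z powi j *
             q powi (int n * (3 * int n + 1) div 2 - j ^ 2) * (1 - q ^ (2*n+1))"
      unfolding power_int_of_nat s2a.summand_def s2b.summand_def signed_monomial_def prod.case pent_def[symmetric]
      by (simp add: right_diff_distrib)
  qed
  ultimately show ?thesis
    using rank_theta_product2_eq[OF q False z nz] rank_theta_product2_eq_hecke_series2[OF q False z] by simp
qed

lemma hecke_rogers_3:
  assumes q: "norm q < 1" and z: "z \<noteq> 0"
    and nz: "\<forall>k\<ge>1. z * q ^ k \<noteq> 1 \<and> q ^ k \<noteq> z"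
  shows "(\<lambda>n::nat. \<Sum>j\<in>{- (int n div 2)..int n div 2}. (-1) powi (int n + j) *
             (z ^ (n+1) + z powi (- int n)) *
             q powi ((int n ^ 2 - 3 * j ^ 2 + int n - j) div 2))
      sums ((1 + z) * qpoch_inf (z^2 * q) q * qpoch_inf (q / z^2) q * qpoch_inf q q * rank_gf z q)"
    (is "?f sums ?L")
proof (cases "q = 0")
  case True
  have "?f n = 0" if "n > 0" for n
  proof -
    have "hecke (int n) j \<noteq> 0" if "- (int n div 2) \<le> j" "j \<le> int n div 2" for j
      using hecke_pos[of "int n" j] that \<open>n > 0\<close> by force
    then have "(int n ^ 2 - 3 * j ^ 2 + int n - j) div 2 \<noteq> 0"
      if "- (int n div 2) \<le> j" "j \<le> int n div 2" for j
      using that by (simp add: hecke_def)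
    then show ?thesis by (simp add: True)
  qed
  then have "?f sums ?f 0" by (rule sums_first)
  then show ?thesis by (simp add: True add.commute)
next
  case False
  have "(\<lambda>n. (\<Sum>j\<in>{- (int n div 2)..int n div 2}. s3a.summand q z (int n + 0, j))
      + (\<Sum>j\<in>{- (int n div 2)..int n div 2}. s3b.summand q z (int n + 0, j))) sums hecke_series3 q z"
    unfolding hecke_series3_def
    by (intro sums_add sums_lattice_rows s3a.summable_on_summand s3b.summable_on_summand q False z) auto
  moreover have "(\<Sum>j\<in>{- (int n div 2)..int n div 2}. s3a.summand q z (int n + 0, j))
      + (\<Sum>j\<in>{- (int n div 2)..int n div 2}. s3b.summand q z (int n + 0, j)) = ?f n" for n
  proof -
    have "z ^ (n + 1) = z powi (int n + 1)"
      by (metis int_plus power_int_of_nat of_nat_1)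
    then show ?thesis
      unfolding sum.distrib[symmetric]
      by (simp only: s3a.summand_def s3b.summand_def signed_monomial_def hecke_def prod.case)
         (simp add: algebra_simps)
  qed
  ultimately show ?thesis
    using rank_theta_product3_eq[OF q False z nz] rank_theta_product3_eq_hecke_series3[OF q False z] by simp
qed

lemma hecke_rogers_4:
  fixes q z :: complex
  defines "A \<equiv> (\<lambda>n::nat. \<Sum>j\<in>{0..2 * int n}. (-1) ^ n * (z powi (j+1) + z powi (-j)) *
                   q powi (3 * int n ^ 2 + 2 * int n - j * (j+1) div 2))"
    and "B \<equiv> (\<lambda>n::nat. \<Sum>j\<in>{0..2 * int (n+1) - 2}. (-1) ^ (n+1) * (z powi (j+1) + z powi (-j)) *
                   q powi (3 * int (n+1) ^ 2 - 2 * int (n+1) - j * (j+1) div 2))"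
  assumes q: "norm q < 1" and z: "z \<noteq> 0"
    and nz: "\<forall>k\<ge>1. z * q ^ k \<noteq> 1 \<and> q ^ k \<noteq> z"
  shows "summable A \<and> summable B \<and>
          (1 + z) * qpoch_inf (z^2 * q^2) (q^2) * qpoch_inf (q^2 / z^2) (q^2) * qpoch_inf (q^2) (q^2)
            * rank_gf z q = suminf A - suminf B"
proof (cases "q = 0")
  case True
  have t: "2 * (j * (j + 1) div 2) = j * (j + 1)" for j :: int
    by simp
  have "A n = 0" if "n > 0" for n
  proof -
    have "3 * int n ^ 2 + 2 * int n - j * (j+1) div 2 \<noteq> 0" if "0 \<le> j" "j \<le> 2 * int n" for j
    proof -
      have "j * (j + 1) \<le> (2 * int n) * (2 * int n + 1)"
        using that by (intro mult_mono) auto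
      then have "j * (j + 1) \<le> 4 * int n ^ 2 + 2 * int n"
        by (simp add: algebra_simps power2_eq_square)
      then show ?thesis
        using t[of j] \<open>n > 0\<close> zero_le_power2[of "int n"] by linarith
    qed
    then show ?thesis by (simp add: A_def True)
  qed
  then have "A sums A 0" by (rule sums_first)
  moreover have "B n = 0" for n
  proof -
    define m where "m = int (n + 1)"
    have "m \<ge> 1" by (simp add: m_def)
    have "3 * m ^ 2 - 2 * m - j * (j+1) div 2 \<noteq> 0" if "0 \<le> j" "j \<le> 2 * m - 2" for j
    proof -
      have "j * (j + 1) \<le> (2 * m - 2) * (2 * m - 1)"
        using that by (intro mult_mono) auto
      then have "j * (j + 1) \<le> 4 * m ^ 2 - 6 * m + 2"
        by (simp add: algebra_simps power2_eq_square)
      \<comment> \<open>The exponent is at least \<open>m^2 + m - 1\<close>, hence positive even in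
        the first row \<open>m = 1\<close>; so all of \<open>B\<close> vanishes and
        \<open>A 0\<close> alone gives \<open>1 + z\<close>.\<close>
      moreover have "1 \<le> m\<^sup>2" using \<open>m \<ge> 1\<close> by simp
      ultimately show ?thesis
        using t[of j] \<open>m \<ge> 1\<close> by linarith
    qed
    then show ?thesis unfolding B_def m_def[symmetric] by (simp add: True)
  qed
  then have "B sums 0" using sums_0[of B] by simp
  moreover have "A 0 = z + 1" by (simp add: A_def True)
  ultimately show ?thesis by (simp add: sums_iff True add.commute)
next
  case False
  \<comment> \<open>The index \<open>j\<close> and its reflection \<open>- j - 1\<close> have the
    same exponent of \<open>q\<close>, so the folded row has a common power of
    \<open>q\<close>.\<close>
  have triangular: "triangular (j + 1) = j * (j + 1) div 2" "triangular (- j) = j * (j + 1) div 2" for j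
    using two_triangular[of "- j"] by (simp_all add: triangular_def mult.commute algebra_simps)
  have m1: "(-1 :: complex) powi (1 + int n) = (-1) ^ (n + 1)" for n
    by (metis add.commute int_plus power_int_of_nat of_nat_1)
  have "(\<lambda>n. \<Sum>j\<in>{- (2 * int n) - 1..2 * int n}. s4a.summand q z (int n + 0, j)) sums
      infsum (s4a.summand q z) {(n, j). 0 \<le> n \<and> - 2 * n - 1 \<le> j \<and> j \<le> 2 * n}"
    by (rule sums_lattice_rows[OF s4a.summable_on_summand[OF q False z]]) auto
  moreover have "(\<Sum>j\<in>{- (2 * int n) - 1..2 * int n}. s4a.summand q z (int n + 0, j)) = A n" for n
  proof -
    have "(\<Sum>j\<in>{- (2 * int n) - 1..2 * int n}. s4a.summand q z (int n + 0, j)) =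
        (\<Sum>j\<in>{0..2 * int n}. s4a.summand q z (int n + 0, j) + s4a.summand q z (int n + 0, - j - 1))"
      by (rule sum_symmetric_int) simp
    also have "\<dots> = A n"
      unfolding A_def s4a.summand_def signed_monomial_def prod.case
      by (rule sum.cong) (simp_all add: triangular ring_distribs)
    finally show ?thesis .
  qed
  ultimately have A: "A sums infsum (s4a.summand q z) {(n, j). 0 \<le> n \<and> - 2 * n - 1 \<le> j \<and> j \<le> 2 * n}"
    by simp
  \<comment> \<open>The second sum starts at 1, so \<open>B n\<close> is its row
    \<open>n + 1\<close> and the rows are enumerated with offset 1.\<close>
  have "(\<lambda>n. \<Sum>j\<in>{- (2 * int (n + 1) - 2) - 1..2 * int (n + 1) - 2}. s4b.summand q z (int n + 1, j)) sums
      infsum (s4b.summand q z) {(n, j). 1 \<le> n \<and> - 2 * n + 1 \<le> j \<and> j \<le> 2 * n - 2}"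
    by (rule sums_lattice_rows[OF s4b.summable_on_summand[OF q False z]]) auto
  moreover have "(\<Sum>j\<in>{- (2 * int (n + 1) - 2) - 1..2 * int (n + 1) - 2}. s4b.summand q z (int n + 1, j)) = B n" for n
  proof -
    have "(\<Sum>j\<in>{- (2 * int (n + 1) - 2) - 1..2 * int (n + 1) - 2}. s4b.summand q z (int n + 1, j)) =
        (\<Sum>j\<in>{0..2 * int (n + 1) - 2}. s4b.summand q z (int n + 1, j) + s4b.summand q z (int n + 1, - j - 1))"
      by (rule sum_symmetric_int) simp
    also have "\<dots> = B n"
      unfolding B_def s4b.summand_def signed_monomial_def prod.case
      by (rule sum.cong) (simp_all add: triangular ring_distribs m1 add_ac)
    finally show ?thesis .
  qed
  ultimately have B: "B sums infsum (s4b.summand q z) {(n, j). 1 \<le> n \<and> - 2 * n + 1 \<le> j \<and> j \<le> 2 * n - 2}"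
    by simp
  show ?thesis
    using A B rank_theta_product4_eq[OF q False z nz] rank_theta_product4_eq_hecke_series4[OF q False z]
    by (simp add: sums_iff hecke_series4_def)
qed

theorem theorem2p4:
  fixes z q :: complex
  assumes "norm q < 1" and "z \<noteq> 0"
  shows
   "((\<forall>k::nat. k \<ge> 1 \<longrightarrow> z * q ^ k \<noteq> 1 \<and> q ^ k \<noteq> z) \<longrightarrow>
      (\<lambda>n::nat. (1/2) *
         ((\<Sum>j\<in>{0..int n div 2}. (-1) powi (int n + j) *
             (z powi (int n - 3*j) + z powi (3*j - int n)) *
             q powi ((int n ^ 2 - 3 * j ^ 2 + int n - j) div 2))
        + (\<Sum>j\<in>{1..int n div 2}. (-1) powi (int n + j) *
             (z powi (int n - 3*j + 1) + z powi (3*j - int n - 1)) *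
             q powi ((int n ^ 2 - 3 * j ^ 2 + int n + j) div 2))))
      sums (qpoch_inf (z * q) q * qpoch_inf (q / z) q * qpoch_inf q q * rank_gf z q))
  \<and> ((\<forall>k::nat. k \<ge> 1 \<longrightarrow> z * q ^ (2*k) \<noteq> 1 \<and> q ^ (2*k) \<noteq> z) \<longrightarrow>
      (\<lambda>n::nat. \<Sum>j\<in>{- int n..int n}. (-1) powi j * z powi j *
             q powi (int n * (3 * int n + 1) div 2 - j ^ 2) * (1 - q ^ (2*n+1)))
      sums (qpoch_inf (z * q) q * qpoch_inf (q / z) q * qpoch_inf q q * rank_gf z (q ^ 2)))
  \<and> ((\<forall>k::nat. k \<ge> 1 \<longrightarrow> z * q ^ k \<noteq> 1 \<and> q ^ k \<noteq> z) \<longrightarrow>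
      (\<lambda>n::nat. \<Sum>j\<in>{- (int n div 2)..int n div 2}. (-1) powi (int n + j) *
             (z ^ (n+1) + z powi (- int n)) *
             q powi ((int n ^ 2 - 3 * j ^ 2 + int n - j) div 2))
      sums ((1 + z) * qpoch_inf (z^2 * q) q * qpoch_inf (q / z^2) q * qpoch_inf q q * rank_gf z q))
  \<and> ((\<forall>k::nat. k \<ge> 1 \<longrightarrow> z * q ^ k \<noteq> 1 \<and> q ^ k \<noteq> z) \<longrightarrow>
      (let A = (\<lambda>n::nat. \<Sum>j\<in>{0..2 * int n}. (-1) ^ n * (z powi (j+1) + z powi (-j)) *
                   q powi (3 * int n ^ 2 + 2 * int n - j * (j+1) div 2));
           B = (\<lambda>n::nat. \<Sum>j\<in>{0..2 * int (n+1) - 2}. (-1) ^ (n+1) * (z powi (j+1) + z powi (-j)) *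
                   q powi (3 * int (n+1) ^ 2 - 2 * int (n+1) - j * (j+1) div 2))
       in summable A \<and> summable B \<and>
          (1 + z) * qpoch_inf (z^2 * q^2) (q^2) * qpoch_inf (q^2 / z^2) (q^2) * qpoch_inf (q^2) (q^2)
            * rank_gf z q = suminf A - suminf B))"
  unfolding Let_def
  by (intro conjI impI hecke_rogers_1 hecke_rogers_2 hecke_rogers_3 hecke_rogers_4[THEN conjunct1]
      hecke_rogers_4[THEN conjunct2, THEN conjunct1] hecke_rogers_4[THEN conjunct2, THEN conjunct2] assms)

end
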